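(* Let $G$ be a $2$-connected graph that is $\{P_5, K_4^{-}\}$-free. Then $G$ contains a longest cycle (i.e. a cycle of maximum length among all cycles of $G$) which is a dominating cycle of $G$.
   Context: All graphs are finite and simple. A cycle $C$ in a graph $G$ is dominating if every edge of $G$ is incident with a vertex of $C$. For a set $\mathcal{H}$ of connected graphs, $G$ is $\mathcal{H}$-free if $G$ does not contain any member of $\mathcal{H}$ as an induced subgraph. $P_5$ is the path of order $5$ (five vertices). $K_4^{-}$ is the graph obtained from the complete graph of order $4$ by removing one edge. *)

theory Defs
  imports "Graph_Theory.Graph_Theory"
begin

text \<open>Finite simple graphs are the \<^locale>\<open>graph\<close>s of the library: finite symmetric digraphs
  without loops and without parallel arcs. An undirected edge is a pair of opposite arcs.\<close>

definition k_connected :: "nat \<Rightarrow> ('a, 'b) pre_digraph \<Rightarrow> bool" where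
  "k_connected k G \<longleftrightarrow> card (verts G) > k \<and>
     (\<forall>X \<subseteq> verts G. card X < k \<longrightarrow> connected (G \<restriction> (verts G - X)))"

definition induced_free :: "('c, 'd) pre_digraph set \<Rightarrow> ('a, 'b) pre_digraph \<Rightarrow> bool" where
  "induced_free \<H> G \<longleftrightarrow> \<not> (\<exists>H \<in> \<H>. \<exists>K. induced_subgraph K G \<and> digraph_iso H K)"

definition P5 :: "(nat, nat \<times> nat) pre_digraph" where
  "P5 = with_proj \<lparr> pverts = {0..<5},
     parcs = {(i, j). i < 5 \<and> j < 5 \<and> (j = Suc i \<or> i = Suc j)} \<rparr>"

definition K4_minus :: "(nat, nat \<times> nat) pre_digraph" where
  "K4_minus = with_proj \<lparr> pverts = {0..<4},
     parcs = {(i, j). i < 4 \<and> j < 4 \<and> i \<noteq> j} - {(0, 1), (1, 0)} \<rparr>"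

text \<open>A directed cycle of length 2 traverses a single undirected edge back and forth, so it is not
  a cycle of the simple graph. The length of a cycle is the length of its arc list.\<close>

definition graph_cycle :: "('a, 'b) pre_digraph \<Rightarrow> 'b awalk \<Rightarrow> bool" where
  "graph_cycle G C \<longleftrightarrow> pre_digraph.cycle G C \<and> length C \<ge> 3"

definition longest_cycle :: "('a, 'b) pre_digraph \<Rightarrow> 'b awalk \<Rightarrow> bool" where
  "longest_cycle G C \<longleftrightarrow> graph_cycle G C \<and> (\<forall>D. graph_cycle G D \<longrightarrow> length D \<le> length C)"

text \<open>On a closed walk every vertex is the tail of some arc of the walk.\<close>

definition cycle_verts :: "('a, 'b) pre_digraph \<Rightarrow> 'b awalk \<Rightarrow> 'a set" where
  "cycle_verts G C = tail G ` set C"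

definition dominating_cycle :: "('a, 'b) pre_digraph \<Rightarrow> 'b awalk \<Rightarrow> bool" where
  "dominating_cycle G C \<longleftrightarrow> graph_cycle G C \<and>
     (\<forall>e \<in> arcs G. tail G e \<in> cycle_verts G C \<or> head G e \<in> cycle_verts G C)"

lemma graph_P5: "graph P5"
proof -
  have "finite {(i, j). i < 5 \<and> j < (5::nat) \<and> (j = Suc i \<or> i = Suc j)}"
    by (rule finite_subset[of _ "{..<5} \<times> {..<5}"]) auto
  then have "pair_graph \<lparr> pverts = {0..<5},
     parcs = {(i, j). i < 5 \<and> j < (5::nat) \<and> (j = Suc i \<or> i = Suc j)} \<rparr>"
    by unfold_locales (auto simp: symmetric_def sym_def)
  then show ?thesis unfolding P5_def by (rule pair_graph.pair_graphD_graph)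
qed

lemma graph_K4_minus: "graph K4_minus"
proof -
  have "finite ({(i, j). i < 4 \<and> j < (4::nat) \<and> i \<noteq> j} - {(0, 1), (1, 0)})"
    by (rule finite_subset[of _ "{..<4} \<times> {..<4}"]) auto
  then have "pair_graph \<lparr> pverts = {0..<4},
     parcs = {(i, j). i < 4 \<and> j < (4::nat) \<and> i \<noteq> j} - {(0, 1), (1, 0)} \<rparr>"
    by unfold_locales (auto simp: symmetric_def sym_def)
  then show ?thesis unfolding K4_minus_def by (rule pair_graph.pair_graphD_graph)
qed

end

theory Submission
  imports Defs
begin

text \<open>
  In fact every longest cycle \<open>C\<close> dominates. Otherwise some component of \<open>G - C\<close> has an edge; let
  \<open>D\<close> be its vertex set, and call a vertex of \<open>C\<close> attached if it has a neighbour in \<open>D\<close>. Write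
  \<open>x\<^sup>+\<close> and \<open>x\<^sup>-\<close> for the neighbours of \<open>x\<close> along \<open>C\<close>. Rerouting \<open>C\<close> through \<open>D\<close> never gives a
  longer cycle, so attached vertices are not consecutive, two attached vertices at distance two
  along \<open>C\<close> have one and the same single neighbour in \<open>D\<close>, and \<open>x\<^sup>+\<close>, \<open>y\<^sup>+\<close> are nonadjacent for
  distinct attached \<open>x\<close>, \<open>y\<close> (lemmas \<open>gap\<close>, \<open>succs_nonadjacent\<close>). The contradiction comes from
  combining these facts with the two forbidden subgraphs; a diamond is a \<open>K\<^sub>4\<close> minus an edge. Say
  that an attached vertex is full if it is adjacent to all of \<open>D\<close>. If some attached vertex is full,
  then \<open>D\<close> is a clique, because a neighbourhood in a diamond-free graph is a disjoint union of
  cliques.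

  \<^item> A full \<open>x\<close> and a nonfull \<open>y\<close> cannot both be attached (\<open>one_full_all_full\<close>): these facts
    make \<open>y\<^sup>+\<close> and \<open>y\<^sup>-\<close> adjacent to \<open>x\<close> and then force the vertex two steps after \<open>y\<close> to
    be attached and nonfull again. Stepping on by two, one goes all the way around \<open>C\<close> and meets
    \<open>x\<close>, or an attached neighbour of \<open>x\<close>.

  \<^item> It cannot be that no attached vertex is full (\<open>full_exists\<close>). A nonfull \<open>x\<close> is adjacent to the
    whole segment of \<open>C\<close> up to the next attached vertex. Since \<open>G\<close> is \<open>2\<close>-connected, some two
    consecutive attached vertices \<open>x\<close>, \<open>y\<close> are at distance at least three, so that their segment
    forms a clique with \<open>x\<close> and \<open>y\<close>. An analysis of the attached vertex after \<open>y\<close> starts another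
    walk by steps of two, from \<open>y\<close>, along attached vertices whose only neighbour in \<open>D\<close> is that of
    \<open>y\<close>; it would have to reach \<open>x\<close>, which has no common neighbour with \<open>y\<close> in \<open>D\<close>.

  \<^item> So all attached vertices are full and form a clique together with \<open>D\<close>. Every other vertex of
    \<open>C\<close> is adjacent to at most one of them, and the vertices between consecutive attached \<open>x\<close>, \<open>y\<close>
    are adjacent to \<open>x\<close> and \<open>y\<close> alternately (\<open>segment_alternates\<close>). A third attached vertex would
    give an induced \<open>P\<^sub>5\<close> or diamond (\<open>no_three_hubs\<close>), so \<open>x\<close> and \<open>y\<close> are the only ones, and the rest of
    \<open>C\<close> is perfectly matched by edges \<open>ba\<close> of \<open>C\<close> with \<open>b\<close> adjacent to \<open>y\<close> and \<open>a\<close> adjacent to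
    \<open>x\<close>. Any two of these edges are linked by an edge from the \<open>a\<close> of one to the \<open>b\<close> of the other,
    again because there is no induced \<open>P\<^sub>5\<close>. They therefore form a semicomplete digraph, which has
    a Hamiltonian path: a path of \<open>G\<close> from a neighbour of \<open>y\<close> to a neighbour of \<open>x\<close> through all
    of \<open>C\<close> except \<open>x\<close> and \<open>y\<close>. Closed up through \<open>x\<close>, two vertices of \<open>D\<close> and \<open>y\<close>, it is a cycle
    longer than \<open>C\<close>.
\<close>

section \<open>Cycles and connected sets of an adjacency relation\<close>

definition is_cycle :: "('a \<Rightarrow> 'a \<Rightarrow> bool) \<Rightarrow> 'a list \<Rightarrow> bool" where
  "is_cycle E zs \<longleftrightarrow> distinct zs \<and> 3 \<le> length zs \<and> successively E zs \<and> E (last zs) (hd zs)"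

definition connected_set :: "('a \<Rightarrow> 'a \<Rightarrow> bool) \<Rightarrow> 'a set \<Rightarrow> bool" where
  "connected_set E D \<longleftrightarrow> (\<forall>u\<in>D. \<forall>v\<in>D. (\<lambda>x y. E x y \<and> x \<in> D \<and> y \<in> D)\<^sup>*\<^sup>* u v)"

lemma connected_set_induct:
  assumes "connected_set E D" "a \<in> D" "b \<in> D" "P a"
    and "\<And>x y. x \<in> D \<Longrightarrow> y \<in> D \<Longrightarrow> E x y \<Longrightarrow> P x \<Longrightarrow> P y"
  shows "P b"
proof -
  have "(\<lambda>x y. E x y \<and> x \<in> D \<and> y \<in> D)\<^sup>*\<^sup>* a b"
    using assms(1-3) unfolding connected_set_def by blast
  then show ?thesis
    by (induction rule: rtranclp_induct) (use assms(4,5) in blast)+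
qed

lemma connected_set_path:
  assumes "connected_set E D" "a \<in> D" "b \<in> D"
  obtains p where "p \<noteq> []" "distinct p" "set p \<subseteq> D" "successively E p" "hd p = a" "last p = b"
proof -
  have "\<exists>p. p \<noteq> [] \<and> distinct p \<and> set p \<subseteq> D \<and> successively E p \<and> hd p = a \<and> last p = b"
    using assms
  proof (rule connected_set_induct)
    show "\<exists>p. p \<noteq> [] \<and> distinct p \<and> set p \<subseteq> D \<and> successively E p \<and> hd p = a \<and> last p = a"
      using \<open>a \<in> D\<close> by (intro exI[of _ "[a]"]) auto
  next
    fix x y
    assume "x \<in> D" "y \<in> D" "E x y"
      and "\<exists>p. p \<noteq> [] \<and> distinct p \<and> set p \<subseteq> D \<and> successively E p \<and> hd p = a \<and> last p = x"
    then obtain p where p: "p \<noteq> []" "distinct p" "set p \<subseteq> D" "successively E p" "hd p = a"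
      "last p = x" by blast
    show "\<exists>p. p \<noteq> [] \<and> distinct p \<and> set p \<subseteq> D \<and> successively E p \<and> hd p = a \<and> last p = y"
    proof (cases "y \<in> set p")
      case True
      then obtain q r where "p = q @ y # r" by (meson split_list)
      with p show ?thesis
        by (intro exI[of _ "q @ [y]"]) (auto simp: successively_append_iff hd_append split: if_splits)
    next
      case False
      with p \<open>E x y\<close> \<open>y \<in> D\<close> show ?thesis
        by (intro exI[of _ "p @ [y]"]) (auto simp: successively_append_iff)
    qed
  qed
  then show thesis using that by blast
qed

section \<open>Hamiltonian paths of semicomplete relations\<close>
lemma semicomplete_insert:
  assumes "successively R ys" "\<And>y. y \<in> set ys \<Longrightarrow> R z y \<or> R y z"
  shows "\<exists>us vs. ys = us @ vs \<and> successively R (us @ z # vs)"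
  using assms
proof (induction ys)
  case (Cons y ys)
  show ?case
  proof (cases "R z y")
    case True
    then show ?thesis
      using Cons.prems by (intro exI[of _ "[]"] exI[of _ "y # ys"]) (auto simp: successively_Cons)
  next
    case False
    then have "R y z" using Cons.prems by auto
    moreover obtain us vs where uv: "ys = us @ vs" "successively R (us @ z # vs)"
      using Cons by (auto simp: successively_Cons)
    ultimately have "successively R ((y # us) @ z # vs)"
      using Cons.prems by (cases us) (auto simp: successively_Cons)
    then show ?thesis using uv by (intro exI[of _ "y # us"] exI[of _ vs]) simp
  qed
qed simp

text \<open>Redei's theorem: a new element can be inserted into a path just before the first element that
  it does not have to follow.\<close>
lemma semicomplete_hamiltonian_path:
  assumes "finite M" "\<And>x y. x \<in> M \<Longrightarrow> y \<in> M \<Longrightarrow> x \<noteq> y \<Longrightarrow> R x y \<or> R y x"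
  obtains ys where "set ys = M" "distinct ys" "successively R ys"
proof -
  have "\<exists>ys. set ys = M \<and> distinct ys \<and> successively R ys"
    using assms
  proof (induction M rule: finite_induct)
    case (insert z M)
    then obtain ys where ys: "set ys = M" "distinct ys" "successively R ys" by auto
    then obtain us vs where "ys = us @ vs" "successively R (us @ z # vs)"
      using semicomplete_insert[of R ys z] insert by (metis insertCI)
    then show ?case using ys insert(2) by (intro exI[of _ "us @ z # vs"]) auto
  qed simp
  then show thesis using that by blast
qed

section \<open>A component outside a longest cycle\<close>

text \<open>
  The cycle is an \<open>n\<close>-periodic family \<open>c\<close> indexed by the integers, so that any attached vertex can
  serve as the origin and reversing the orientation is the substitution of \<open>- i\<close> for \<open>i\<close>. The
  premises of \<open>p5\<close> together with the negated conclusion already force the five vertices to be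
  distinct. The assumption \<open>robust\<close> is what \<open>2\<close>-connectedness contributes: no single vertex \<open>v\<close>
  meets all edges between \<open>D\<close> and the cycle. In particular \<open>D\<close> has two elements.
\<close>
locale outside_component =
  fixes E :: "'a \<Rightarrow> 'a \<Rightarrow> bool" and c :: "int \<Rightarrow> 'a" and n :: int and D :: "'a set"
  assumes sym: "E u v \<Longrightarrow> E v u"
    and irrefl: "\<not> E u u"
    and p5: "E u v \<Longrightarrow> E v w \<Longrightarrow> E w x \<Longrightarrow> E x y \<Longrightarrow>
      E u w \<or> E u x \<or> E u y \<or> E v x \<or> E v y \<or> E w y"
    and diamond: "E u v \<Longrightarrow> E u w \<Longrightarrow> E v w \<Longrightarrow> E u x \<Longrightarrow> E v x \<Longrightarrow> w \<noteq> x \<Longrightarrow> E w x"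
    and n_ge_3: "3 \<le> n"
    and periodic: "c (i + n) = c i"
    and inj: "c i = c j \<Longrightarrow> n dvd i - j"
    and step: "E (c i) (c (i + 1))"
    and longest: "is_cycle E zs \<Longrightarrow> int (length zs) \<le> n"
    and off: "c i \<notin> D"
    and conn: "connected_set E D"
    and robust: "\<exists>d\<in>D. \<exists>i. E d (c i) \<and> d \<noteq> v \<and> c i \<noteq> v"
begin

lemma reversed: "outside_component E (\<lambda>i. c (- i)) n D"
proof
  show "E (c (- i)) (c (- (i + 1)))" for i
    using sym[OF step[of "- i - 1"]] by simp
  show "c (- (i + n)) = c (- i)" for i
    using periodic[of "- i - n"] by (simp add: algebra_simps)
  show "n dvd i - j" if "c (- i) = c (- j)" for i j
    using inj[OF that] by (simp add: dvd_diff_commute)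
  show "\<exists>d\<in>D. \<exists>i. E d (c (- i)) \<and> d \<noteq> v \<and> c (- i) \<noteq> v" for v
    using robust[of v] by (metis minus_minus)
qed (use sym irrefl p5 diamond n_ge_3 longest off conn in blast)+

lemma step_Suc: "E (c (i + 1)) (c (i + 2))"
  using step[of "i + 1"] by (simp only: add.assoc one_add_one)

lemma periodic_mult: "c (i + k * n) = c i"
proof -
  have pos: "c (i + int m * n) = c i" for i m
  proof (induction m)
    case (Suc m)
    have "c (i + int (Suc m) * n) = c ((i + int m * n) + n)" by (simp add: algebra_simps)
    then show ?case using Suc periodic by simp
  qed simp
  show ?thesis
  proof (cases "k \<ge> 0")
    case True
    then show ?thesis using pos[of i "nat k"] by simp
  next
    case False
    then show ?thesis using pos[of "i + k * n" "nat (- k)"] by simp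
  qed
qed

lemma inj_window: "c i = c j \<Longrightarrow> \<bar>i - j\<bar> < n \<Longrightarrow> i = j"
  using inj[of i j] by (metis dvd_imp_le_int abs_of_pos diff_eq_eq add_0 linorder_not_le n_ge_3
      order_less_le_trans zero_less_numeral)

lemma shift_window:
  obtains k where "i \<le> j + k * n" "j + k * n < i + n"
proof
  have n: "0 < n" using n_ge_3 by simp
  have eq: "j + - ((j - i) div n) * n = i + (j - i) mod n"
    using div_mult_mod_eq[of "j - i" n] by (simp add: algebra_simps)
  show "i \<le> j + - ((j - i) div n) * n" "j + - ((j - i) div n) * n < i + n"
    unfolding eq using n by simp_all
qed

lemma successively_arc: "successively E (map c [i..j])"
proof (induction "nat (j - i)" arbitrary: i)
  case 0
  then have "j = i \<or> j < i" by linarith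
  then show ?case by auto
next
  case (Suc m)
  then have "i < j" by simp
  then have "[i..j] = i # [i+1..j]" "[i+1..j] = (i+1) # [i+1+1..j]"
    by (simp_all add: upto_rec1)
  then show ?case using Suc(1)[of "i+1"] Suc(2) step by simp
qed

lemma distinct_arc: "j < i + n \<Longrightarrow> distinct (map c [i..j])"
  by (auto simp: distinct_map intro!: inj_onI inj_window)

lemma hd_arc: "i \<le> j \<Longrightarrow> hd (map c [i..j]) = c i"
  by (simp add: upto_rec1)

lemma last_arc: "i \<le> j \<Longrightarrow> last (map c [i..j]) = c j"
  by (simp add: upto_rec2)

definition att :: "'a \<Rightarrow> bool" where
  "att v \<longleftrightarrow> (\<exists>d\<in>D. E d v)"

text \<open>A path in \<open>D\<close> can replace the piece of the cycle between its two ends' attachments, so that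
  piece has at least as many inner vertices as the path has vertices.\<close>
lemma gap:
  assumes p: "p \<noteq> []" "distinct p" "set p \<subseteq> D" "successively E p"
    and "E (hd p) (c i)" "E (last p) (c j)" "i < j" "j < i + n"
  shows "int (length p) < j - i"
proof -
  let ?zs = "p @ map c [j..i + n]"
  have "is_cycle E ?zs"
    unfolding is_cycle_def
  proof (intro conjI)
    show "distinct ?zs"
      using p distinct_arc[of "i + n" j] off assms by (auto simp del: distinct_map)
    have "1 \<le> length p" "2 \<le> length [j..i + n]" using p(1) assms by (auto simp: Suc_le_eq)
    then show "3 \<le> length ?zs" unfolding length_append length_map by linarith
    show "successively E ?zs"
      unfolding successively_append_iff
      using p assms successively_arc hd_arc[of j "i + n"] by auto
    show "E (last ?zs) (hd ?zs)"
      using assms last_arc[of j "i + n"] periodic[of i] by (auto intro: sym)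
  qed
  from longest[OF this] show ?thesis using assms by simp
qed

lemma att_next: "att (c i) \<Longrightarrow> \<not> att (c (i + 1))"
proof
  assume "att (c i)" "att (c (i + 1))"
  then obtain a b where ab: "a \<in> D" "b \<in> D" "E a (c i)" "E b (c (i + 1))"
    unfolding att_def by blast
  obtain p where "p \<noteq> []" "distinct p" "set p \<subseteq> D" "successively E p" "hd p = a" "last p = b"
    using connected_set_path[OF conn ab(1,2)] .
  then show False using gap[of p i "i + 1"] ab n_ge_3 by simp
qed

lemma att_two_steps:
  assumes "a \<in> D" "b \<in> D" "E a (c i)" "E b (c (i + 2))"
  shows "a = b"
proof (rule ccontr)
  assume "a \<noteq> b"
  obtain p where p: "p \<noteq> []" "distinct p" "set p \<subseteq> D" "successively E p" "hd p = a" "last p = b"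
    using connected_set_path[OF conn assms(1,2)] .
  then have "int (length p) < 2" using gap[of p i "i + 2"] assms n_ge_3 by simp
  then obtain x where "p = [x]" using p by (cases p) auto
  then show False using p \<open>a \<noteq> b\<close> by simp
qed

text \<open>With \<open>x = c i\<close> and \<open>y = c k\<close>, an edge between the successors would give the longer cycle that
  runs from \<open>x\<close> through \<open>D\<close> to \<open>y\<close>, back along the cycle to \<open>x\<^sup>+\<close>, over to \<open>y\<^sup>+\<close> and forward
  to \<open>x\<close>.\<close>
lemma succs_nonadjacent:
  assumes "att (c i)" "att (c j)" "c i \<noteq> c j"
  shows "\<not> E (c (i + 1)) (c (j + 1))"
proof
  assume adj: "E (c (i + 1)) (c (j + 1))"
  obtain t where t: "i \<le> j + t * n" "j + t * n < i + n" by (rule shift_window)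
  define k where "k = j + t * n"
  have k: "c k = c j" "c (k + 1) = c (j + 1)"
    using periodic_mult[of j t] periodic_mult[of "j + 1" t] by (simp_all add: k_def algebra_simps)
  have ik: "i < k" "k < i + n" using t assms(3) k(1) unfolding k_def by (cases "i = j + t * n"; auto)+
  obtain a b where ab: "a \<in> D" "b \<in> D" "E a (c i)" "E b (c k)"
    using assms k unfolding att_def by auto
  obtain p where p: "p \<noteq> []" "distinct p" "set p \<subseteq> D" "successively E p" "hd p = a" "last p = b"
    using connected_set_path[OF conn ab(1,2)] .
  let ?u = "map c [i + 1..k]" and ?w = "map c [k + 1..i + n]"
  let ?zs = "p @ rev ?u @ ?w"
  have uw: "[i + 1..k] @ [k + 1..i + n] = [i + 1..i + n]"
    using ik by (simp add: upto_split2[symmetric])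
  have len: "length ?u + length ?w = nat n" using ik by simp
  have ne: "?u \<noteq> []" "?w \<noteq> []" using ik by auto
  have "is_cycle E ?zs"
    unfolding is_cycle_def
  proof (intro conjI)
    have "distinct (?u @ ?w)"
      unfolding map_append[symmetric] uw by (rule distinct_arc) simp
    then show "distinct ?zs"
      using p off by (auto simp del: distinct_map)
    show "3 \<le> length ?zs" using len n_ge_3 by simp
    have "successively E (rev ?u)"
      using successively_arc[of "i + 1" k] sym
      by (metis (no_types, lifting) successively_mono successively_rev)
    moreover have "hd (rev ?u) = c k" "last (rev ?u) = c (i + 1)" "hd ?w = c (k + 1)"
      using ne ik hd_arc[of "i + 1" k] last_arc[of "i + 1" k] hd_arc[of "k + 1" "i + n"]
      by (simp_all add: hd_rev last_rev)
    ultimately show "successively E ?zs"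
      unfolding successively_append_iff
      using p ab adj k successively_arc[of "k + 1" "i + n"] ne by (auto simp: hd_append)
    show "E (last ?zs) (hd ?zs)"
      using ne p ab ik last_arc[of "k + 1" "i + n"] periodic[of i] by (auto intro: sym)
  qed
  then have "int (length ?zs) \<le> n" by (rule longest)
  moreover have "length ?zs = length p + nat n"
    unfolding length_append length_rev using len by linarith
  ultimately have "int (length p + nat n) \<le> n" by argo
  then show False using p(1) n_ge_3 by simp
qed

lemma att_prev: "att (c i) \<Longrightarrow> \<not> att (c (i - 1))"
  using att_next[of "i - 1"] by auto

lemma att_other:
  obtains j where "att (c j)" "c j \<noteq> v"
  using robust[of v] unfolding att_def by blast

lemma next_att:
  assumes "att (c i)"
  obtains j where "i < j" "j < i + n" "att (c j)" "\<And>k. i < k \<Longrightarrow> k < j \<Longrightarrow> \<not> att (c k)"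
proof -
  obtain j where j: "att (c j)" "c j \<noteq> c i" by (rule att_other)
  obtain t where t: "i \<le> j + t * n" "j + t * n < i + n" by (rule shift_window)
  define P where "P m \<longleftrightarrow> att (c (i + 1 + int m))" for m :: nat
  have "i \<noteq> j + t * n" using j periodic_mult[of j t] by metis
  then have "P (nat (j + t * n - i - 1))" 
    using j t periodic_mult[of j t] unfolding P_def by simp
  then have least: "P (LEAST m. P m)" "(LEAST m. P m) \<le> nat (j + t * n - i - 1)"
    by (auto intro: LeastI Least_le)
  show thesis
  proof (rule that[of "i + 1 + int (LEAST m. P m)"])
    show "att (c (i + 1 + int (LEAST m. P m)))" using least(1) unfolding P_def .
    show "i + 1 + int (LEAST m. P m) < i + n" using least(2) t \<open>i \<noteq> _\<close> by linarith
    show "\<not> att (c k)" if "i < k" "k < i + 1 + int (LEAST m. P m)" for k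
    proof -
      have "nat (k - i - 1) < (LEAST m. P m)" using that by linarith
      then have "\<not> P (nat (k - i - 1))" by (rule not_less_Least)
      then show ?thesis using that unfolding P_def by simp
    qed
  qed simp
qed

lemma prev_att:
  assumes "att (c i)"
  obtains j where "j < i" "i < j + n" "att (c j)" "\<And>k. j < k \<Longrightarrow> k < i \<Longrightarrow> \<not> att (c k)"
proof -
  interpret R: outside_component E "\<lambda>i. c (- i)" n D by (rule reversed)
  obtain j where j: "- i < j" "j < - i + n" "att (c (- j))"
    "\<And>k. - i < k \<Longrightarrow> k < j \<Longrightarrow> \<not> att (c (- k))"
    using R.next_att[of "- i"] assms by auto
  show thesis
    by (rule that[of "- j"]) (use j j(4)[of "- k" for k] in auto)
qed

text \<open>The positions reached by steps of two have either the parity of \<open>j\<close>, or they include a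
  position next to \<open>j\<close>; the latter is impossible since attached vertices are not consecutive.\<close>
lemma walk_by_two:
  assumes "P (c i)" "\<And>v. P v \<Longrightarrow> att v" "\<And>k. P (c k) \<Longrightarrow> P (c (k + 2))" "att (c j)"
  shows "P (c j)"
proof -
  have even: "P (c (i + 2 * int m))" for m
  proof (induction m)
    case (Suc m)
    then show ?case using assms(3)[of "i + 2 * int m"] by (simp add: algebra_simps)
  qed (use assms in simp)
  obtain t where t: "i \<le> j + t * n" "j + t * n < i + n" by (rule shift_window)
  define m where "m = nat (j + t * n - i)"
  have j: "c (i + int m) = c j" using t periodic_mult[of j t] by (simp add: m_def)
  show ?thesis
  proof (cases "even m")
    case True
    then show ?thesis using even[of "m div 2"] j by auto
  next
    case False
    then have m: "i + int m = i + 2 * int (m div 2) + 1" by presburger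
    have "\<not> att (c (i + int m))"
      unfolding m using even[of "m div 2"] assms(2) att_next by blast
    then show ?thesis using assms(4) j by simp
  qed
qed

text \<open>A shortest connection of \<open>x\<close> and \<open>q\<close> through \<open>D\<close>, prolonged by \<open>u\<close> and \<open>w\<close>, would be an induced
  path on at least five vertices. It has at most two vertices in \<open>D\<close>: because of \<open>u\<close>, every vertex
  of \<open>D\<close> is a neighbour of \<open>x\<close> or adjacent to one in \<open>D\<close>.\<close>
lemma crossing_neighbours:
  assumes "att x" "att q" "\<not> E x q" "E u x" "\<not> E u q" "E q w" "\<not> E x w" "\<not> E u w"
    and "\<not> att u" "\<not> att w" "u \<notin> D" "w \<notin> D" "x \<notin> D" "q \<notin> D"
  shows False
proof -
  have no: "\<not> E d u" "\<not> E d w" if "d \<in> D" for d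
    using that assms(9,10) unfolding att_def by auto
  have common: False if "d \<in> D" "E d x" "E d q" for d
    using p5[of u x d q w] no[OF that(1)] that assms sym by blast
  obtain a b where ab: "a \<in> D" "E a x" "b \<in> D" "E b q" using assms unfolding att_def by blast
  have "E b x \<or> (\<exists>p\<in>D. E p x \<and> E p b)"
  proof (rule connected_set_induct[OF conn ab(1,3)])
    show "E a x \<or> (\<exists>p\<in>D. E p x \<and> E p a)" using ab by blast
    show "E s x \<or> (\<exists>p\<in>D. E p x \<and> E p s)"
      if "r \<in> D" "s \<in> D" "E r s" and r: "E r x \<or> (\<exists>p\<in>D. E p x \<and> E p r)" for r s
      using r
    proof
      assume "\<exists>p\<in>D. E p x \<and> E p r"
      then obtain p where "p \<in> D" "E p x" "E p r" by blast
      then show ?thesis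
        using p5[of u x p r s] no that assms(4) sym by blast
    qed (use that in blast)
  qed
  then show False
  proof
    assume "\<exists>p\<in>D. E p x \<and> E p b"
    then obtain p where "p \<in> D" "E p x" "E p b" by blast
    then show False
      using p5[of u x p b q] no common ab assms sym by blast
  qed (use common ab in blast)
qed

section \<open>Full and nonfull attached vertices exclude each other\<close>
definition full :: "'a \<Rightarrow> bool" where
  "full v \<longleftrightarrow> (\<forall>d\<in>D. E d v)"

lemma shift_eq: "c i = c j \<Longrightarrow> c (i + m) = c (j + m)"
proof -
  assume "c i = c j"
  then obtain t where "i - j = n * t" using inj by (metis dvdE)
  then have "i + m = (j + m) + t * n" by (simp add: algebra_simps)
  then show ?thesis using periodic_mult by metis
qed

lemma att_nonadjacent: "\<not> att v \<Longrightarrow> d \<in> D \<Longrightarrow> \<not> E d v" "\<not> att v \<Longrightarrow> d \<in> D \<Longrightarrow> \<not> E v d"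
  unfolding att_def using sym by blast+

text \<open>The neighbourhood of \<open>x\<close> is a disjoint union of cliques and contains the connected set \<open>D\<close>.\<close>
lemma full_clique:
  assumes "full x" "a \<in> D" "b \<in> D" "a \<noteq> b"
  shows "E a b"
proof -
  have "a = b \<or> E a b"
  proof (rule connected_set_induct[OF conn assms(2,3)])
    show "a = s \<or> E a s" if "r \<in> D" "s \<in> D" "E r s" "a = r \<or> E a r" for r s
      using diamond[of x r a s] that assms sym unfolding full_def by blast
  qed simp
  with assms show ?thesis by simp
qed

lemma full_nonfull_nonadjacent:
  assumes "full x" "att y" "\<not> full y" "x \<notin> D" "y \<notin> D"
  shows "\<not> E x y"
proof
  assume "E x y"
  obtain d e where "d \<in> D" "E d y" "e \<in> D" "\<not> E e y" using assms unfolding att_def full_def by blast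
  then show False
    using diamond[of x d y e] full_clique[OF \<open>full x\<close>, of d e] assms sym \<open>E x y\<close>
    unfolding full_def by blast
qed

text \<open>With \<open>x = c i\<close>, \<open>y = c k\<close> and a common neighbour \<open>d\<close> in \<open>D\<close>, the path \<open>x\<^sup>+ x d y y\<^sup>+\<close> forces
  \<open>x\<^sup>+\<close> to be adjacent to \<open>y\<close> if \<open>y\<^sup>+\<close> is not adjacent to \<open>x\<close>; but then \<open>y\<^sup>+ y x\<^sup>+ x e\<close> is induced for
  any \<open>e\<close> in \<open>D\<close> that is not adjacent to \<open>y\<close>.\<close>
lemma nonfull_succ_adjacent_full:
  assumes x: "att (c i)" "full (c i)" and y: "att (c k)" "\<not> full (c k)"
  shows "E (c (k + 1)) (c i)"
proof (rule ccontr)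
  assume not: "\<not> E (c (k + 1)) (c i)"
  obtain d e where de: "d \<in> D" "E d (c k)" "e \<in> D" "\<not> E e (c k)"
    using y unfolding att_def full_def by blast
  have xy: "\<not> E (c i) (c k)" "c i \<noteq> c k"
    using full_nonfull_nonadjacent[of "c i" "c k"] x y off by auto
  have na: "\<not> att (c (i + 1))" "\<not> att (c (k + 1))" using x y att_next by auto
  have D: "E d (c i)" "E e (c i)" using x de unfolding full_def by auto
  have adj: "E (c (i + 1)) (c k)"
    using p5[of "c (i + 1)" "c i" d "c k" "c (k + 1)"] succs_nonadjacent[OF x(1) y(1) xy(2)]
      not xy D de na[THEN att_nonadjacent(1)] na[THEN att_nonadjacent(2)] step sym by blast
  show False
    using p5[of "c (k + 1)" "c k" "c (i + 1)" "c i" e] succs_nonadjacent[OF x(1) y(1) xy(2)]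
      not xy D de na[THEN att_nonadjacent(1)] na[THEN att_nonadjacent(2)] step sym adj by blast
qed

lemma nonfull_pred_adjacent_full:
  assumes "att (c i)" "full (c i)" and "att (c k)" "\<not> full (c k)"
  shows "E (c (k - 1)) (c i)"
proof -
  interpret R: outside_component E "\<lambda>i. c (- i)" n D by (rule reversed)
  show ?thesis
    using R.nonfull_succ_adjacent_full[of "- i" "- k"] assms by (simp add: algebra_simps)
qed

text \<open>Being attached and nonfull propagates by two steps along the cycle as soon as some full vertex
  exists, so it would spread to the full vertex itself.\<close>
lemma one_full_all_full:
  assumes x: "att (c i)" "full (c i)" and "att (c j)"
  shows "full (c j)"
proof (rule ccontr)
  assume "\<not> full (c j)"
  define P where "P v \<longleftrightarrow> att v \<and> \<not> full v" for v
  have "P (c i)"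
  proof (rule walk_by_two[of P j])
    show "P (c j)" using assms \<open>\<not> full (c j)\<close> unfolding P_def by simp
    show "P (c (k + 2))" if "P (c k)" for k
    proof -
      have y: "att (c k)" "\<not> full (c k)" using that unfolding P_def by auto
      obtain d e where de: "d \<in> D" "E d (c k)" "e \<in> D" "\<not> E e (c k)"
        using y unfolding att_def full_def by blast
      have "d \<noteq> e" using de by blast
      then have ed: "E e d" using full_clique[OF x(2)] de sym by blast
      have xy: "\<not> E (c i) (c k)" "c i \<noteq> c k"
        using full_nonfull_nonadjacent[of "c i" "c k"] x y off by auto
      have D: "E d (c i)" "E e (c i)" using x de unfolding full_def by auto
      have na: "\<not> att (c (k + 1))" "\<not> att (c (k - 1))" using y att_next att_prev by auto
      have succ: "E (c (k + 1)) (c i)" and pred: "E (c (k - 1)) (c i)"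
        using nonfull_succ_adjacent_full nonfull_pred_adjacent_full x y by blast+
      have steps: "E (c k) (c (k + 1))" "E (c (k - 1)) (c k)" "E (c (k + 1)) (c (k + 2))"
        using step[of k] step[of "k - 1"] step_Suc[of k] by simp_all
      have ne: "c (k + 1) \<noteq> c (k - 1)" using inj_window[of "k + 1" "k - 1"] n_ge_3 by auto
      have "att (c (k + 2))"
      proof (rule ccontr)
        assume na2: "\<not> att (c (k + 2))"
        note no = na[THEN att_nonadjacent(1)] na[THEN att_nonadjacent(2)]
          na2[THEN att_nonadjacent(1)] na2[THEN att_nonadjacent(2)]
        have s: "E (c k) (c (k + 2))"
          using p5[of e d "c k" "c (k + 1)" "c (k + 2)"] de ed no steps sym by blast
        \<comment> \<open>Otherwise the nonadjacent \<open>y\<close> and \<open>x\<close> would both be adjacent to \<open>y\<^sup>+\<close> and its successor.\<close>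
        have xs: "\<not> E (c (k + 2)) (c i)"
          using diamond[OF steps(3) sym[OF steps(1)] sym[OF s] succ] xy sym by metis
        \<comment> \<open>Now the neighbours \<open>y\<^sup>+\<close>, its successor and \<open>y\<^sup>-\<close> of \<open>y\<close> lie in one clique, while the common
          neighbours \<open>y\<^sup>+\<close>, \<open>y\<^sup>-\<close> of the nonadjacent vertices \<open>y\<close> and \<open>x\<close> have to be nonadjacent.\<close>
        have "E (c (k + 2)) (c (k - 1))"
          using p5[of "c (k + 2)" "c k" "c (k - 1)" "c i" e] s steps pred D xs xy de no sym by blast
        then have "E (c (k + 1)) (c (k - 1))"
          using diamond[of "c k" "c (k + 2)" "c (k + 1)" "c (k - 1)"] s steps ne sym by blast
        then show False
          using diamond[OF _ sym[OF steps(1)] steps(2) succ pred] xy sym by metis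
      qed
      moreover have "\<not> full (c (k + 2))"
        using att_two_steps[OF de(1,3,2)] de \<open>d \<noteq> e\<close> unfolding full_def by blast
      ultimately show ?thesis unfolding P_def by simp
    qed
  qed (use x in \<open>auto simp: P_def\<close>)
  then show False using x unfolding P_def by simp
qed

section \<open>Some attached vertex is full\<close>

text \<open>There is an edge \<open>ab\<close> in \<open>D\<close> with \<open>a\<close> but not \<open>b\<close> adjacent to \<open>x\<close>. The path \<open>b a x w z\<close> may not
  be induced.\<close>
lemma nonfull_absorbs:
  assumes "att x" "\<not> full x" "\<not> att w" "\<not> att z" "E x w" "E w z"
  shows "E x z"
proof -
  have "\<exists>a\<in>D. \<exists>b\<in>D. E a b \<and> E a x \<and> \<not> E b x"
  proof (rule ccontr)
    assume no: "\<not> ?thesis"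
    obtain a where a: "a \<in> D" "E a x" using assms unfolding att_def by blast
    have "E b x" if "b \<in> D" for b
      by (rule connected_set_induct[OF conn a(1) that, of "\<lambda>v. E v x"]) (use a no in blast)+
    then show False using assms unfolding full_def by blast
  qed
  then obtain a b where ab: "a \<in> D" "b \<in> D" "E a b" "E a x" "\<not> E b x" by blast
  then show ?thesis
    using p5[of b a x w z] assms(5,6) att_nonadjacent[OF assms(3)] att_nonadjacent[OF assms(4)] sym
    by blast
qed

lemma nonfull_segment:
  assumes "att (c i)" "\<not> full (c i)" "\<And>k. i < k \<Longrightarrow> k < j \<Longrightarrow> \<not> att (c k)" "i < k" "k < j"
  shows "E (c i) (c k)"
proof -
  have "k < j \<longrightarrow> E (c i) (c k)"
  proof (rule int_ge_induct[of "i + 1" k])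
    show "i + 1 \<le> k" using assms by simp
    show "i + 1 < j \<longrightarrow> E (c i) (c (i + 1))" using step by simp
    show "l + 1 < j \<longrightarrow> E (c i) (c (l + 1))" if "i + 1 \<le> l" "l < j \<longrightarrow> E (c i) (c l)" for l
      using that nonfull_absorbs[OF assms(1,2), of "c l" "c (l + 1)"] assms(3) step by simp
  qed
  then show ?thesis using assms by simp
qed

lemma nonfull_segment_rev:
  assumes "att (c j)" "\<not> full (c j)" "\<And>k. i < k \<Longrightarrow> k < j \<Longrightarrow> \<not> att (c k)" "i < k" "k < j"
  shows "E (c j) (c k)"
proof -
  interpret R: outside_component E "\<lambda>i. c (- i)" n D by (rule reversed)
  have "\<not> att (c (- l))" if "- j < l" "l < - i" for l using assms(3)[of "- l"] that by simp
  then show ?thesis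
    using R.nonfull_segment[of "- j" "- i" "- k"] assms by simp
qed

text \<open>Otherwise attached vertices are two steps apart all around the cycle, all of them have the same
  single neighbour \<open>d\<close> in \<open>D\<close>, and \<open>d\<close> is a cut vertex.\<close>
lemma long_segment_exists:
  obtains i where "att (c i)" "\<not> att (c (i + 2))"
proof -

  have "\<exists>i. att (c i) \<and> \<not> att (c (i + 2))"
  proof (rule ccontr)
    assume no: "\<not> ?thesis"
    obtain i where i: "att (c i)" by (rule att_other)
    then obtain d where d: "d \<in> D" "E d (c i)" unfolding att_def by blast
    define P where "P v \<longleftrightarrow> att v \<and> (\<forall>b\<in>D. E b v \<longrightarrow> b = d)" for v
    have "P (c j)" if "att (c j)" for j
    proof (rule walk_by_two[of P i])
      obtain e where "e \<in> D" "E e (c (i + 2))" using no i unfolding att_def by blast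
      then show "P (c i)" using i att_two_steps d unfolding P_def by blast
      show "P (c (k + 2))" if P: "P (c k)" for k
      proof -
        have "E d (c k)" "att (c k)" using P unfolding P_def att_def by blast+
        then show ?thesis using no att_two_steps[OF d(1)] unfolding P_def by blast
      qed
    qed (use that in \<open>auto simp: P_def\<close>)
    moreover obtain e j where "e \<in> D" "E e (c j)" "e \<noteq> d" using robust[of d] by blast
    ultimately show False unfolding P_def att_def by blast
  qed
  then show thesis using that by blast
qed

lemma full_exists: "\<exists>i. att (c i) \<and> full (c i)"
proof (rule ccontr)
  assume "\<not> ?thesis"
  then have nf: "\<not> full (c i)" if "att (c i)" for i using that by blast
  obtain i where i: "att (c i)" "\<not> att (c (i + 2))" by (rule long_segment_exists)
  obtain j where j: "i < j" "j < i + n" "att (c j)" "\<And>k. i < k \<Longrightarrow> k < j \<Longrightarrow> \<not> att (c k)"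
    using next_att[OF i(1)] by blast
  have "j \<noteq> i + 1" "j \<noteq> i + 2" using j(3) i(2) att_next[OF i(1)] by auto
  then have "i + 2 < j" using j(1) by linarith
  define x y u u' where "x = c i" and "y = c j" and "u = c (i + 1)" and "u' = c (i + 2)"
  have xy: "att x" "att y" "x \<noteq> y"
    using i j inj_window[of i j] unfolding x_def y_def by auto
  have nu: "\<not> att u" "\<not> att u'" using \<open>i + 2 < j\<close> j(4) unfolding u_def u'_def by auto
  have seg: "E x (c k)" "E y (c k)" if "i < k" "k < j" for k
    using nonfull_segment[of i j k] nonfull_segment_rev[of j i k] i j nf that
    unfolding x_def y_def by blast+
  have adj: "E x u" "E x u'" "E y u" "E y u'" "E u u'"
    unfolding u_def u'_def using seg \<open>i + 2 < j\<close> step_Suc[of i] by simp_all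
  \<comment> \<open>The segment after \<open>x\<close> is a clique together with \<open>x\<close> and \<open>y\<close>, so by diamond-freeness a
    vertex with two neighbours in it is adjacent to all of it.\<close>
  have Exy: "E x y" using diamond[of u u' x y] adj xy sym by blast
  have disj: False if "b \<in> D" "E b x" "E b y" for b
    using diamond[of x y u b] that adj Exy nu att_nonadjacent sym by (metis off u_def)
  have uy: "\<not> E u (c (j + 1))"
    unfolding u_def using succs_nonadjacent[OF i(1) j(3)] xy x_def y_def by simp
  have une: "u \<noteq> c (j + 1)" using inj_window[of "i + 1" "j + 1"] j unfolding u_def by auto
  have Ey: "E y (c (j + 1))" unfolding y_def by (rule step)
  have xy1: "\<not> E x (c (j + 1))"
    using diamond[of x y u "c (j + 1)"] Exy adj Ey uy une by blast
  \<comment> \<open>A nonfull vertex adjacent to \<open>u\<close> is also adjacent to \<open>u'\<close>, hence to that whole clique.\<close>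
  have attach_u: "E (c m) x \<and> E (c m) y" if "att (c m)" "c m \<noteq> x" "c m \<noteq> y" "E (c m) u" for m
  proof -
    have "E (c m) u'" using nonfull_absorbs[OF that(1) nf[OF that(1)] nu that(4)] adj by blast
    then show ?thesis
      using diamond[of u u' "c m"] that adj sym by blast
  qed
  obtain k where k: "j < k" "k < j + n" "att (c k)" "\<And>l. j < l \<Longrightarrow> l < k \<Longrightarrow> \<not> att (c l)"
    using next_att[OF j(3)] by blast
  have na: "\<not> att (c (j + 1))" using att_next[OF j(3)] .
  \<comment> \<open>The next segment cannot be long as well. If it were, its end \<open>z\<close> would be adjacent to \<open>y\<close>:
    either \<open>x\<close>, \<open>y\<close>, \<open>z\<close> form a triangle and the cliques of the two segments are glued together, or
    \<open>u\<close> and \<open>y\<^sup>+\<close> are private neighbours of the nonadjacent vertices \<open>x\<close> and \<open>z\<close>.\<close>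
  have "k = j + 2"
  proof (rule ccontr)
    assume "k \<noteq> j + 2"
    moreover have "k \<noteq> j + 1" using na k(3) by auto
    ultimately have kj: "j + 2 < k" using k(1) by linarith
    define z where "z = c k"
    have z: "att z" "z \<noteq> y" using k inj_window[of k j] unfolding z_def y_def by auto
    have zadj: "E z (c (j + 1))" "E z (c (j + 2))" "E y (c (j + 2))" "E (c (j + 1)) (c (j + 2))"
      using nonfull_segment[of j k "j + 2"] nonfull_segment_rev[of k j "j + 1"]
        nonfull_segment_rev[of k j "j + 2"] j(3) k(3,4) nf kj step_Suc[of j]
      unfolding z_def y_def by simp_all
    have "E y z" using diamond[of "c (j + 1)" "c (j + 2)" y z] zadj Ey z sym by blast
    have "z \<noteq> x" using zadj xy1 by blast
    show False
    proof (cases "E x z")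
      case True
      have "z \<noteq> u" using z nu by blast
      then have "E u z" using diamond[of x y u z] True \<open>E y z\<close> Exy adj by blast
      then show False using diamond[of y z u "c (j + 1)"] \<open>E y z\<close> adj Ey zadj une uy sym by blast
    next
      case False
      then have "\<not> E z u" using attach_u[OF k(3)] \<open>z \<noteq> x\<close> z sym unfolding z_def by blast
      then show False
        using crossing_neighbours[of x z u "c (j + 1)"] xy z False adj zadj xy1 uy nu na off sym
        unfolding x_def z_def u_def by blast
    qed
  qed
  obtain b where b: "b \<in> D" "E b y" using xy unfolding att_def by blast
  \<comment> \<open>Nonadjacency to \<open>y\<close> is carried along because it makes \<open>u y b v v\<^sup>+\<close> an induced path unless \<open>v\<^sup>+\<close>
    is adjacent to \<open>y\<close>. At \<open>y\<close> itself, where the walk starts and which it may pass again, the step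
    is the shortness of the next segment.\<close>
  define P where "P v \<longleftrightarrow> att v \<and> (\<forall>d\<in>D. E d v \<longleftrightarrow> d = b) \<and> \<not> E v y" for v
  have "P (c i)"
  proof (rule walk_by_two[of P j])
    obtain e where "e \<in> D" "E e (c (j + 2))" using k(3) \<open>k = j + 2\<close> unfolding att_def by blast
    then show "P (c j)"
      using att_two_steps[of _ e j] b xy irrefl unfolding P_def y_def by metis
    show "P (c (l + 2))" if P: "P (c l)" for l
    proof -
      have l: "att (c l)" "\<not> E (c l) y" and lb: "\<And>d. d \<in> D \<Longrightarrow> E d (c l) \<longleftrightarrow> d = b"
        using P unfolding P_def by auto
      have nl: "\<not> att (c (l + 1))" using att_next[OF l(1)] .
      have "E y (c (l + 1)) \<and> att (c (l + 2))"
      proof (cases "c l = y")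
        case True
        then have "c (l + 2) = c (j + 2)" using shift_eq[of l j 2] unfolding y_def by simp
        then show ?thesis using k(3) \<open>k = j + 2\<close> step[of l] True by simp
      next
        case False
        have lx: "c l \<noteq> x" using disj[OF b(1)] b lb[of b] by blast
        have "\<not> E (c l) u" using attach_u[OF l(1)] lx False l by blast
        moreover have "\<not> E u (c (l + 1))"
          unfolding u_def using succs_nonadjacent[OF i(1) l(1)] lx unfolding x_def by metis
        ultimately have yl: "E y (c (l + 1))"
          using p5[of u y b "c l" "c (l + 1)"] adj b l lb[of b] step[of l] sym
            nu(1)[THEN att_nonadjacent(2)] nl[THEN att_nonadjacent(1)] by blast
        have st: "E (c (l + 1)) (c (l + 2))" by (rule step_Suc)
        have "att (c (l + 2))"
        proof (rule ccontr)
          assume "\<not> att (c (l + 2))"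
          then have "E y (c (l + 2))" "E (c l) (c (l + 2))"
            using nonfull_absorbs[OF _ _ nl _ _ st] yl step l nf xy j(3) unfolding y_def by blast+
          then show False
            using diamond[of "c (l + 1)" "c (l + 2)" "c l" y] st yl step[of l] l False sym by blast
        qed
        with yl show ?thesis ..
      qed
      then have yl: "E y (c (l + 1))" and l2: "att (c (l + 2))" by auto
      have only: "E d (c (l + 2)) \<longleftrightarrow> d = b" if "d \<in> D" for d
        using l2 att_two_steps[OF b(1)] b lb[of b] that unfolding att_def by blast
      then have b_l2: "E b (c (l + 2))" using b by simp
      have "\<not> E (c (l + 2)) y"
      proof
        assume "E (c (l + 2)) y"
        moreover have "c (l + 1) \<noteq> b" using off b by metis
        ultimately have "E (c (l + 1)) b"
          using diamond[of y "c (l + 2)" "c (l + 1)" b] yl sym[OF step_Suc[of l]] sym b b_l2 by metis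
        then show False using nl b att_nonadjacent by blast
      qed
      then show ?thesis using l2 only unfolding P_def by blast
    qed
  qed (use i in \<open>auto simp: P_def\<close>)
  then have "E b x" using b unfolding P_def x_def by blast
  then show False using disj b by blast
qed

section \<open>All attached vertices are full\<close>
lemma att_full: "att (c i) \<Longrightarrow> full (c i)"
  using full_exists one_full_all_full by blast

lemma two_in_component:
  obtains d e where "d \<in> D" "e \<in> D" "d \<noteq> e" "E d e"
proof -
  obtain i where "att (c i)" by (rule att_other)
  then have "full (c i)" by (rule att_full)
  moreover obtain d where "d \<in> D" using robust by blast
  moreover obtain e where "e \<in> D" "e \<noteq> d" using robust[of d] by blast
  ultimately show thesis using that[of d e] full_clique by blast
qed

text \<open>The vertices of the cycle are now of two kinds. The hubs form a clique with \<open>D\<close>; each inner vertex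
  has at most one hub as a neighbour, which splits the inner vertices according to their hub.\<close>
definition hub :: "'a \<Rightarrow> bool" where
  "hub v \<longleftrightarrow> v \<in> range c \<and> att v"

definition inner :: "'a \<Rightarrow> bool" where
  "inner v \<longleftrightarrow> v \<in> range c \<and> \<not> att v"

lemma hub_adjacent_component: "hub x \<Longrightarrow> d \<in> D \<Longrightarrow> E x d"
  using att_full sym unfolding hub_def full_def by blast

lemma inner_nonadjacent_component: "inner p \<Longrightarrow> d \<in> D \<Longrightarrow> \<not> E d p"
  unfolding inner_def att_def by blast

lemma hubs_adjacent:
  assumes "hub x" "hub y" "x \<noteq> y"
  shows "E x y"
proof -
  obtain d e where "d \<in> D" "e \<in> D" "d \<noteq> e" "E d e" by (rule two_in_component)
  then show ?thesis using diamond[of d e x y] hub_adjacent_component assms sym by blast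
qed

text \<open>Two hubs and a vertex of \<open>D\<close> form a triangle, and \<open>p\<close> would complete a diamond.\<close>
lemma inner_one_hub:
  assumes "hub x" "hub y" "inner p" "E x p" "E y p"
  shows "x = y"
proof (rule ccontr)
  assume "x \<noteq> y"
  obtain d e where d: "d \<in> D" "e \<in> D" "d \<noteq> e" "E d e" by (rule two_in_component)
  have "p \<noteq> d" using assms(3) d(1) off unfolding inner_def by blast
  then have "E d p"
    using diamond[of x y p d] hubs_adjacent hub_adjacent_component assms d \<open>x \<noteq> y\<close> sym by blast
  then show False using inner_nonadjacent_component assms d by blast
qed

text \<open>A vertex of \<open>D\<close> prolongs the path \<open>x p q r\<close> to one on five vertices.\<close>
lemma hub_pendant:
  assumes "hub x" "inner p" "inner q" "inner r"
    and "E x p" "E p q" "E q r" "\<not> E x q" "\<not> E x r"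
  shows "E p r"
proof -
  obtain d where "d \<in> D" using robust by blast
  then show ?thesis
    using p5[of d x p q r] hub_adjacent_component inner_nonadjacent_component assms sym by blast
qed

text \<open>Otherwise \<open>q\<close> is adjacent to \<open>p'\<close> as well, by \<open>hub_pendant\<close> at \<open>y\<close>, and \<open>p p'\<close> is the central
  edge of a diamond with \<open>x\<close> and \<open>q\<close>.\<close>
lemma same_hub_nonadjacent:
  assumes "hub x" "hub y" "x \<noteq> y" "inner p" "inner p'" "inner q"
    and "E x p" "E x p'" "E y q" "E p q"
  shows "\<not> E p p'"
proof
  assume "E p p'"
  have "\<not> E y p" "\<not> E y p'" "\<not> E x q" using inner_one_hub assms by blast+
  then have "E q p'" using hub_pendant[of y q p p'] assms \<open>E p p'\<close> sym by blast
  moreover have "x \<noteq> q" using assms unfolding hub_def inner_def by blast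
  ultimately show False
    using diamond[of p p' x q] assms \<open>E p p'\<close> \<open>\<not> E x q\<close> sym by blast
qed

text \<open>The path \<open>q p y p' q'\<close> may not be induced, but any edge between its two halves makes \<open>q q'\<close> an
  edge, and then the nonadjacent \<open>p\<close> and \<open>p'\<close> are both adjacent to \<open>q\<close> and \<open>q'\<close>.\<close>
lemma no_three_hubs:
  assumes "hub x" "hub y" "hub z" "x \<noteq> y" "y \<noteq> z" "x \<noteq> z"
    and "inner p" "inner q" "inner p'" "inner q'"
    and "E x q" "E y p" "E y p'" "E z q'" "E p q" "E p' q'" "p \<noteq> p'"
  shows False
proof -
  have no: "\<not> E x p" "\<not> E x p'" "\<not> E x q'" "\<not> E y q" "\<not> E y q'" "\<not> E z q" "\<not> E z p" "\<not> E z p'"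
    using inner_one_hub assms by blast+
  have pp: "\<not> E p p'" using same_hub_nonadjacent[of y x p p' q] assms by blast
  have "E q p' \<or> E q q' \<or> E p q'" using p5[of q p y p' q'] pp no assms sym by blast
  then have qq: "E q q'"
    using hub_pendant[of x q p q'] hub_pendant[of z q' p' q] no assms sym by blast
  have "E q p'" "E q' p"
    using hub_pendant[of x q q' p'] hub_pendant[of z q' q p] qq no assms sym by blast+
  then show False using diamond[of q q' p p'] qq pp assms sym by blast
qed

text \<open>This is what happens if two consecutive inner vertices of the segment from \<open>x\<close> to \<open>y\<close> avoid \<open>x\<close>:
  the end of the segment hangs as a clique at a vertex \<open>p\<close> adjacent to \<open>x\<close>. The edge \<open>p' q'\<close> leaves
  the neighbourhood of \<open>x\<close> elsewhere. Every edge between the two structures creates a diamond or an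
  induced \<open>P\<^sub>5\<close>, and without such edges \<open>t p x p' q'\<close> is induced.\<close>
lemma no_hanging_triangle:
  assumes "hub x" "hub y" "x \<noteq> y"
    and "inner p" "inner s" "inner t" "inner p'" "inner q'"
    and "E p s" "E p t" "E s t" "E x p" "\<not> E x s" "E y t" "\<not> E y s"
    and "E x p'" "p' \<noteq> p" "\<not> E x q'" "E p' q'"
  shows False
proof -
  have no: "\<not> E x t" "\<not> E y p" "\<not> E y p'" using inner_one_hub assms by blast+
  have pp: "\<not> E p p'" using same_hub_nonadjacent[of x y p p' t] assms by blast
  have tp: "\<not> E t p'"
    using hub_pendant[of x p' t s] diamond[of s t p p'] pp no assms sym by blast
  have tq: "\<not> E t q'"
    using hub_pendant[of x p' q' t] no tp assms sym by blast
  have "\<not> E p q'"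
  proof
    assume pq: "E p q'"
    have "t \<noteq> q'" using tp assms sym by blast
    then have "E t q'"
      using hub_pendant[of y t p q'] hub_pendant[of y q' p s] diamond[of p s t q'] pq no assms sym
      by blast
    then show False using tq by simp
  qed
  then show False using p5[of t p x p' q'] pp tp tq no assms sym by blast
qed

text \<open>The segment that arrives at a hub from another hub \<open>c m\<close> starts with a vertex not adjacent to it
  and ends with an adjacent one.\<close>
lemma hub_entry_edge:
  assumes i: "att (c i)"
  obtains t m where "m < t" "t + 1 < i" "i < m + n" "att (c m)"
    "inner (c t)" "inner (c (t + 1))" "\<not> E (c i) (c t)" "E (c i) (c (t + 1))"
proof -
  obtain m where m: "m < i" "i < m + n" "att (c m)" "\<And>k. m < k \<Longrightarrow> k < i \<Longrightarrow> \<not> att (c k)"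
    using prev_att[OF i] by blast
  have "\<exists>t>m. t + 1 < i \<and> \<not> E (c i) (c t) \<and> E (c i) (c (t + 1))"
  proof (rule ccontr)
    assume no: "\<not> ?thesis"
    have ne: "c m \<noteq> c i" using inj_window[of i m] m by auto
    have "m + 1 \<noteq> i" using att_next[OF m(3)] i by auto
    then have lt: "m + 1 \<le> i - 1" using m(1) by simp
    have "inner (c (m + 1))" unfolding inner_def using att_next[OF m(3)] by simp
    then have first: "\<not> E (c i) (c (m + 1))"
      using inner_one_hub[of "c i" "c m" "c (m + 1)"] i m(3) ne step[of m] unfolding hub_def by auto
    have "k < i \<longrightarrow> \<not> E (c i) (c k)" if "m + 1 \<le> k" for k
      using that
    proof (induction k rule: int_ge_induct)
      case (step k)
      then show ?case using no by force
    qed (use first in simp)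
    then show False using lt sym[OF step[of "i - 1"]] by force
  qed
  then obtain t where t: "m < t" "t + 1 < i" "\<not> E (c i) (c t)" "E (c i) (c (t + 1))" by blast
  show thesis
    by (rule that[of m t]) (use t m in \<open>auto simp: inner_def\<close>)
qed

text \<open>Take the first two consecutive vertices that are not adjacent to \<open>x = c i\<close>, and the vertex \<open>p\<close>
  before them. Then all later vertices of the segment are adjacent to \<open>p\<close> and not to \<open>x\<close>
  (\<open>hang\<close>), and the last two of them form the forbidden hanging triangle with \<open>p\<close>.\<close>
lemma segment_dense:
  assumes i: "att (c i)" and j: "att (c j)" "i < j" "j < i + n"
    and between: "\<And>k. i < k \<Longrightarrow> k < j \<Longrightarrow> \<not> att (c k)"
    and "i < k" "k + 1 < j"
  shows "E (c i) (c k) \<or> E (c i) (c (k + 1))"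
proof -
  have hubs: "hub (c i)" "hub (c j)" "c i \<noteq> c j"
    using i j inj_window[of i j] unfolding hub_def by auto
  have inn: "inner (c l)" if "i < l" "l < j" for l
    using between that unfolding inner_def by auto
  have "k + 1 < j \<longrightarrow> E (c i) (c k) \<or> E (c i) (c (k + 1))"
  proof (rule int_ge_induct[of "i + 1" k])
    show "i + 1 + 1 < j \<longrightarrow> E (c i) (c (i + 1)) \<or> E (c i) (c (i + 1 + 1))" using step by simp
    fix k
    assume k: "i + 1 \<le> k" and IH: "k + 1 < j \<longrightarrow> E (c i) (c k) \<or> E (c i) (c (k + 1))"
    show "k + 1 + 1 < j \<longrightarrow> E (c i) (c (k + 1)) \<or> E (c i) (c (k + 1 + 1))"
    proof (intro impI, rule ccontr)
      assume kj: "k + 1 + 1 < j"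
        and no: "\<not> (E (c i) (c (k + 1)) \<or> E (c i) (c (k + 1 + 1)))"
      define x y p where "x = c i" and "y = c j" and "p = c k"
      have p: "E x p" "inner p" using IH kj no k inn unfolding x_def p_def by auto
      have first: "E p (c (k + 1))" "\<not> E x (c (k + 1))" "\<not> E x (c (k + 1 + 1))"
        using no step unfolding p_def x_def by auto
      have hang: "l + 1 < j \<longrightarrow> E p (c l) \<and> \<not> E x (c l) \<and> E p (c (l + 1)) \<and> \<not> E x (c (l + 1))"
        if "k + 1 \<le> l" for l
        using that
      proof (induction l rule: int_ge_induct)
        case base
        show ?case
          using hub_pendant[of x p "c (k + 1)" "c (k + 1 + 1)"] hubs p first inn kj k step[of "k + 1"]
          unfolding x_def by simp
      next
        case (step l)
        show ?case
        proof
          assume lj: "l + 1 + 1 < j"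
          define s t w where "s = c l" and "t = c (l + 1)" and "w = c (l + 1 + 1)"
          have st: "E p s" "\<not> E x s" "E p t" "\<not> E x t"
            using step.IH lj unfolding s_def t_def by auto
          have path: "E s t" "E t w"
            unfolding s_def t_def w_def by (fact outside_component.step[OF outside_component_axioms])+
          have ins: "inner s" "inner t" "inner w"
            using inn lj step.hyps k unfolding s_def t_def w_def by auto
          have "p \<noteq> w"
            using inj_window[of k "l + 1 + 1"] lj step.hyps k j unfolding p_def w_def by auto
          have "\<not> E x w"
          proof
            assume "E x w"
            have "E w s"
              using hub_pendant[of x w t s] hubs ins st path \<open>E x w\<close> sym unfolding x_def by blast
            then have "E p w" using diamond[of t s p w] path st \<open>p \<noteq> w\<close> sym by blast
            moreover have "x \<noteq> t" using ins hubs unfolding x_def hub_def inner_def by blast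
            ultimately show False using diamond[of p w x t] path st \<open>E x w\<close> p sym by blast
          qed
          moreover have "E p w"
            using hub_pendant[of x p t w] hubs ins st path p \<open>\<not> E x w\<close> unfolding x_def by blast
          ultimately show "E p (c (l + 1)) \<and> \<not> E x (c (l + 1)) \<and> E p (c (l + 1 + 1)) \<and>
              \<not> E x (c (l + 1 + 1))"
            using st unfolding t_def w_def by simp
        qed
      qed
      define s t where "s = c (j - 2)" and "t = c (j - 1)"
      have st: "E p s" "\<not> E x s" "E p t" "inner s" "inner t"
        using hang[of "j - 2"] kj inn[of "j - 2"] inn[of "j - 1"] k unfolding s_def t_def
        by (auto simp: algebra_simps)
      have path: "E s t" "E y t"
        using step[of "j - 2"] sym[OF step[of "j - 1"]] unfolding s_def t_def y_def
        by (simp_all add: algebra_simps)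
      have "p \<noteq> y" using p hubs unfolding y_def hub_def inner_def by blast
      have "\<not> E y s"
      proof
        assume "E y s"
        then have "E p y" using diamond[of s t p y] path st \<open>p \<noteq> y\<close> sym by blast
        then show False using inner_one_hub[of x y p] hubs p sym unfolding x_def y_def by blast
      qed
      obtain r m where r: "m < r" "r + 1 < i" "i < m + n" "att (c m)"
        "inner (c r)" "inner (c (r + 1))" "\<not> E x (c r)" "E x (c (r + 1))"
        using hub_entry_edge[OF i] unfolding x_def by blast
      have "\<not> m + n < j" using between[of "m + n"] r(3,4) periodic[of m] by auto
      then have "c (r + 1) \<noteq> p"
        using inj_window[of k "r + 1"] r(1,2) k kj unfolding p_def by auto
      then show False
        using no_hanging_triangle[of x y p s t "c (r + 1)" "c r"] hubs p st path \<open>\<not> E y s\<close> r(5-8)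
          sym[OF step[of r]] unfolding x_def y_def by blast
    qed
  qed (use assms in simp)
  then show ?thesis using assms by simp
qed

lemma segment_dense_rev:
  assumes i: "att (c i)" and j: "att (c j)" "i < j" "j < i + n"
    and between: "\<And>k. i < k \<Longrightarrow> k < j \<Longrightarrow> \<not> att (c k)"
    and "i < k" "k + 1 < j"
  shows "E (c j) (c k) \<or> E (c j) (c (k + 1))"
proof -
  interpret R: outside_component E "\<lambda>i. c (- i)" n D by (rule reversed)
  have "\<not> att (c (- l))" if "- j < l" "l < - i" for l using between[of "- l"] that by simp
  then show ?thesis
    using R.segment_dense[of "- j" "- i" "- k - 1"] assms by (auto simp: algebra_simps)
qed

text \<open>Of two consecutive inner vertices at least one is adjacent to each of the two ends, and none is
  adjacent to both ends.\<close>
lemma segment_alternates: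
  assumes i: "att (c i)" and j: "att (c j)" "i < j" "j < i + n"
    and between: "\<And>k. i < k \<Longrightarrow> k < j \<Longrightarrow> \<not> att (c k)"
  shows "i < k \<Longrightarrow> k < j \<Longrightarrow> E (if even (k - i) then c j else c i) (c k)"
    and "odd (j - i)" "i + 3 \<le> j"
proof -
  have hubs: "hub (c i)" "hub (c j)" "c i \<noteq> c j"
    using i j inj_window[of i j] unfolding hub_def by auto
  have inn: "inner (c l)" if "i < l" "l < j" for l
    using between that unfolding inner_def by auto
  have alt: "l < j \<longrightarrow> E (if even (l - i) then c j else c i) (c l)" if "i + 1 \<le> l" for l
    using that
  proof (induction l rule: int_ge_induct)
    case base
    show ?case using step by simp
  next
    case (step l)
    show ?case
    proof
      assume l: "l + 1 < j"
      have both: "E (c i) (c l) \<or> E (c i) (c (l + 1))" "E (c j) (c l) \<or> E (c j) (c (l + 1))"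
        using segment_dense[of i j l] segment_dense_rev[of i j l] assms l step.hyps by auto
      then show "E (if even (l + 1 - i) then c j else c i) (c (l + 1))"
        using step inner_one_hub[OF hubs(1,2) inn[of l]] hubs(3) l by (auto split: if_splits)
    qed
  qed
  then show "i < k \<Longrightarrow> k < j \<Longrightarrow> E (if even (k - i) then c j else c i) (c k)" by simp
  have "j \<noteq> i + 1" using att_next[OF i] j(1) by auto
  then have l: "i + 1 \<le> j - 1" "j - 1 < j" using j(2) by auto
  have "E (c j) (c (j - 1))" using sym[OF step[of "j - 1"]] by simp
  then have "\<not> E (c i) (c (j - 1))"
    using inner_one_hub[OF hubs(1,2) inn[of "j - 1"]] hubs(3) l by auto
  then have "even (j - 1 - i)" using alt[OF l(1)] l(2) by (auto split: if_splits)
  then show "odd (j - i)" by presburger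
  then show "i + 3 \<le> j" using l by presburger
qed

lemma successively_concat_pairs:
  assumes "successively (\<lambda>p q. E (snd p) (fst q)) ps" "\<And>p. p \<in> set ps \<Longrightarrow> E (fst p) (snd p)"
  shows "successively E (concat (map (\<lambda>p. [fst p, snd p]) ps))"
  using assms
proof (induction ps)
  case (Cons p ps)
  then show ?case by (cases ps) auto
qed simp

lemma impossible: False
proof -
  obtain i where i: "att (c i)" by (rule att_other)
  obtain j where j: "i < j" "j < i + n" "att (c j)" "\<And>k. i < k \<Longrightarrow> k < j \<Longrightarrow> \<not> att (c k)"
    using next_att[OF i] by blast
  obtain k where k: "j < k" "k < j + n" "att (c k)" "\<And>l. j < l \<Longrightarrow> l < k \<Longrightarrow> \<not> att (c l)"
    using next_att[OF j(3)] by blast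
  define x y where "x = c i" and "y = c j"
  have xy: "hub x" "hub y" "x \<noteq> y"
    using i j inj_window[of i j] unfolding x_def y_def hub_def by auto
  note S = segment_alternates[OF i j(3,1,2,4)]
  note T = segment_alternates[OF j(3) k(3,1,2,4)]
  have innS: "inner (c l)" if "i < l" "l < j" for l using j(4) that unfolding inner_def by auto
  have innT: "inner (c l)" if "j < l" "l < k" for l using k(4) that unfolding inner_def by auto
  \<comment> \<open>With a third hub, the two vertices of the cycle on either side of \<open>y\<close> contradict
    \<open>no_three_hubs\<close>.\<close>
  have "c k = c i"
  proof (rule ccontr)
    assume "c k \<noteq> c i"
    moreover have "c k \<noteq> y" using inj_window[of k j] k unfolding y_def by auto
    moreover have "c (j - 1) \<noteq> c (j + 1)" using inj_window[of "j - 1" "j + 1"] n_ge_3 by auto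
    moreover have "E x (c (j - 2))" "E (c k) (c (j + 2))"
      using S(1)[of "j - 2"] T(1)[of "j + 2"] S(2,3) T(3) unfolding x_def by auto
    moreover have "E (c (j - 1)) (c (j - 2))" "E (c (j + 1)) (c (j + 2))"
      "E y (c (j - 1))" "E y (c (j + 1))"
      using sym[OF step_Suc[of "j - 3"]] step_Suc[of j] sym[OF step[of "j - 1"]] step[of j]
      unfolding y_def by simp_all
    ultimately show False
      using no_three_hubs[of x y "c k" "c (j - 1)" "c (j - 2)" "c (j + 1)" "c (j + 2)"] xy k(3)
        innS[of "j - 1"] innS[of "j - 2"] innT[of "j + 1"] innT[of "j + 2"] S(3) T(3)
      unfolding x_def hub_def by auto
  qed
  moreover have "k - i < n + n" "0 < k - i" using j k by auto
  ultimately have kn: "k = i + n"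
    using inj_window[of "k" "i + n"] periodic[of i] by auto
  obtain m1 where m1: "j = i + 2 * int m1 + 1"
  proof -
    obtain r where "j - i = 2 * r + 1" using S(2) by (rule oddE)
    then show thesis using that[of "nat r"] j(1) by simp
  qed
  obtain m2 where m2: "k = j + 2 * int m2 + 1"
  proof -
    obtain r where "k - j = 2 * r + 1" using T(2) by (rule oddE)
    then show thesis using that[of "nat r"] k(1) by simp
  qed
  \<comment> \<open>Every second edge of the two segments, as pairs with the neighbour of \<open>y\<close> first.\<close>
  define M where "M = (\<lambda>s. (c (i + 2 * int s + 2), c (i + 2 * int s + 1))) ` {..<m1} \<union>
    (\<lambda>s. (c (j + 2 * int s + 1), c (j + 2 * int s + 2))) ` {..<m2}"
  have M: "inner (fst p) \<and> inner (snd p) \<and> E y (fst p) \<and> E x (snd p) \<and> E (fst p) (snd p)"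
    if "p \<in> M" for p
    using that unfolding M_def
  proof
    assume "p \<in> (\<lambda>s. (c (i + 2 * int s + 2), c (i + 2 * int s + 1))) ` {..<m1}"
    then obtain s where s: "s < m1" "p = (c (i + 2 * int s + 2), c (i + 2 * int s + 1))" by auto
    then show ?thesis
      using S(1)[of "i + 2 * int s + 2"] S(1)[of "i + 2 * int s + 1"] innS m1
        sym[OF step_Suc[of "i + 2 * int s"]] unfolding x_def y_def by auto
  next
    assume "p \<in> (\<lambda>s. (c (j + 2 * int s + 1), c (j + 2 * int s + 2))) ` {..<m2}"
    then obtain s where s: "s < m2" "p = (c (j + 2 * int s + 1), c (j + 2 * int s + 2))" by auto
    then show ?thesis
      using T(1)[of "j + 2 * int s + 2"] T(1)[of "j + 2 * int s + 1"] innT m2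
        step_Suc[of "j + 2 * int s"] \<open>c k = c i\<close> unfolding x_def y_def by auto
  qed
  \<comment> \<open>Two pairs without a link would form an induced path with \<open>x\<close> in the middle.\<close>
  have "finite M" unfolding M_def by simp
  moreover have "E (snd p) (fst q) \<or> E (snd q) (fst p)" if "p \<in> M" "q \<in> M" for p q
  proof -
    have "\<not> E (fst p) (fst q)" "\<not> E (snd p) (snd q)"
      using same_hub_nonadjacent[of y x "fst p" "fst q" "snd p"]
        same_hub_nonadjacent[of x y "snd p" "snd q" "fst p"] M that xy sym by blast+
    moreover have "\<not> E x (fst p)" "\<not> E x (fst q)" using inner_one_hub M that xy by blast+
    ultimately show ?thesis
      using p5[of "fst p" "snd p" x "snd q" "fst q"] M that sym by blast
  qed
  ultimately obtain ps where ps: "set ps = M" "distinct ps"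
    "successively (\<lambda>p q. E (snd p) (fst q)) ps"
    using semicomplete_hamiltonian_path[of M "\<lambda>p q. E (snd p) (fst q)"] by blast

  define Q where "Q = concat (map (\<lambda>p. [fst p, snd p]) ps)"
  have lenQ: "length Q = 2 * card M"
    unfolding Q_def ps(1)[symmetric] distinct_card[OF ps(2)] by (induction ps) auto
  \<comment> \<open>\<open>Q\<close> is at most as long as the number of inner vertices but covers all of them. Hence it is
    distinct.\<close>
  have "card M \<le> m1 + m2"
    unfolding M_def
    by (intro card_Un_le[THEN order_trans] add_mono) (auto intro: card_image_le[THEN order_trans])
  then have lenQ_le: "length Q \<le> 2 * (m1 + m2)" using lenQ by simp
  have innQ: "inner v" if "v \<in> set Q" for v
    using that M unfolding Q_def ps(1)[symmetric] by auto
  let ?I = "{i<..<j} \<union> {j<..<k}"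
  have cover: "c ` ?I \<subseteq> set Q"
  proof
    fix v assume "v \<in> c ` ?I"
    then obtain l where l: "v = c l" "i < l \<and> l < j \<or> j < l \<and> l < k" by auto
    have setQ: "set Q = fst ` M \<union> snd ` M" unfolding Q_def ps(1)[symmetric] by auto
    show "v \<in> set Q"
      using l(2)
    proof
      assume "i < l \<and> l < j"
      then have s: "nat ((l - i - 1) div 2) < m1"
        "l = i + 2 * int (nat ((l - i - 1) div 2)) + (if even (l - i) then 2 else 1)"
        using m1 by (auto; presburger)+
      then show ?thesis unfolding setQ M_def l(1) image_Un image_image fst_conv snd_conv
        by (cases "even (l - i)") (auto simp: image_iff intro!: bexI[of _ "nat ((l - i - 1) div 2)"])
    next
      assume "j < l \<and> l < k"
      then have s: "nat ((l - j - 1) div 2) < m2"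
        "l = j + 2 * int (nat ((l - j - 1) div 2)) + (if even (l - j) then 2 else 1)"
        using m2 by (auto; presburger)+
      then show ?thesis unfolding setQ M_def l(1) image_Un image_image fst_conv snd_conv
        by (cases "even (l - j)") (auto simp: image_iff intro!: bexI[of _ "nat ((l - j - 1) div 2)"])
    qed
  qed
  have "inj_on c ?I" using kn j by (intro inj_onI inj_window) auto
  then have "card (c ` ?I) = card ?I" by (rule card_image)
  also have "\<dots> = card {i<..<j} + card {j<..<k}" by (rule card_Un_disjoint) auto
  also have "\<dots> = 2 * (m1 + m2)" using m1 m2 by simp
  finally have "2 * (m1 + m2) \<le> card (set Q)" using card_mono[OF _ cover] by simp
  then have Q: "length Q = 2 * (m1 + m2)" "distinct Q"
    using lenQ_le card_length[of Q] by (auto intro: card_distinct)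
  have nm: "n = 2 * int (m1 + m2) + 2" using m1 m2 kn by simp
  have "ps \<noteq> []" using Q(1) nm n_ge_3 unfolding Q_def by auto
  then have Qends: "Q \<noteq> []" "hd Q = fst (hd ps)"
    unfolding Q_def by (cases ps; simp)+
  have "last Q = snd (last ps)"
    using \<open>ps \<noteq> []\<close> unfolding Q_def by (cases ps rule: rev_cases) auto
  note Qends = Qends this
  have in_M: "hd ps \<in> M" "last ps \<in> M" using ps(1) \<open>ps \<noteq> []\<close> by auto
  obtain d e where de: "d \<in> D" "e \<in> D" "d \<noteq> e" "E d e" by (rule two_in_component)
  let ?zs = "y # Q @ [x, d, e]"
  have "is_cycle E ?zs"
    unfolding is_cycle_def
  proof (intro conjI)
    have "x \<notin> set Q" "y \<notin> set Q" "d \<notin> set Q" "e \<notin> set Q" "x \<noteq> d" "x \<noteq> e" "y \<noteq> d" "y \<noteq> e"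
      using innQ xy de off unfolding hub_def inner_def by blast+
    then show "distinct ?zs" using Q(2) xy de by auto
    show "3 \<le> length ?zs" by simp
    have "successively E Q"
      unfolding Q_def using ps M by (intro successively_concat_pairs) auto
    moreover have "E y (hd Q)" "E (last Q) x" "E x d"
      using Qends in_M M sym hub_adjacent_component xy de by auto
    ultimately show "successively E ?zs"
      using Qends(1) de(4) by (auto simp: successively_Cons successively_append_iff hd_append)
    show "E (last ?zs) (hd ?zs)" using hub_adjacent_component xy de sym by auto
  qed
  from longest[OF this] Q(1) nm show False by simp
qed

end

section \<open>Induced subgraphs and cycles in terms of adjacency\<close>

text \<open>An adjacency-preserving embedding of vertices extends to arcs: in the absence of parallel arcs
  each arc of the copy is determined by its ends.\<close>
lemma induced_copy:
  assumes G: "graph G" and H: "graph H"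
    and inj: "inj_on f (verts H)" and sub: "f ` verts H \<subseteq> verts G"
    and adj: "\<And>u v. u \<in> verts H \<Longrightarrow> v \<in> verts H \<Longrightarrow>
      (u, v) \<in> arcs_ends H \<longleftrightarrow> (f u, f v) \<in> arcs_ends G"
  shows "\<exists>K. induced_subgraph K G \<and> digraph_iso H K"
proof -
  interpret G: graph G by (rule G)
  interpret H: graph H by (rule H)
  let ?K = "G \<restriction> (f ` verts H)"
  define g where "g e = (SOME e'. e' \<in> arcs G \<and> tail G e' = f (tail H e) \<and> head G e' = f (head H e))"
    for e
  have g: "g e \<in> arcs G \<and> tail G (g e) = f (tail H e) \<and> head G (g e) = f (head H e)"
    if "e \<in> arcs H" for e
  proof -
    have "(f (tail H e), f (head H e)) \<in> arcs_ends G"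
      using that adj[of "tail H e" "head H e"] by (auto simp: arcs_ends_conv)
    then have "\<exists>e'. e' \<in> arcs G \<and> tail G e' = f (tail H e) \<and> head G e' = f (head H e)"
      by (metis reachableE)
    then show ?thesis unfolding g_def by (rule someI_ex)
  qed
  define hom where "hom = \<lparr>iso_verts = f, iso_arcs = g, iso_head = head G, iso_tail = tail G\<rparr>"
  have "inj_on g (arcs H)"
  proof (rule inj_onI)
    fix e e' assume "e \<in> arcs H" "e' \<in> arcs H" "g e = g e'"
    then have "f (tail H e) = f (tail H e')" "f (head H e) = f (head H e')"
      using g by metis+
    then have "tail H e = tail H e'" "head H e = head H e'"
      using \<open>e \<in> arcs H\<close> \<open>e' \<in> arcs H\<close> inj by (auto dest: inj_onD)
    then show "e = e'"
      using \<open>e \<in> arcs H\<close> \<open>e' \<in> arcs H\<close> H.no_multi_arcs[of e e'] by (simp add: arc_to_ends_def)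
  qed
  then have "H.digraph_isomorphism hom"
    unfolding H.digraph_isomorphism_def hom_def using inj g H.wf_digraph_axioms by auto
  moreover have "?K = app_iso hom H"
  proof -
    have "g ` arcs H = arcs ?K"
    proof (intro equalityI subsetI)
      fix e assume e: "e \<in> arcs ?K"
      then obtain u v where uv: "u \<in> verts H" "v \<in> verts H" "tail G e = f u" "head G e = f v" by auto
      then have "(f u, f v) \<in> arcs_ends G"
        using e by (intro G.dominatesI[of e]) (auto simp: arc_to_ends_def)
      then have "(u, v) \<in> arcs_ends H" using uv adj[of u v] by simp
      then obtain a where a: "a \<in> arcs H" "tail H a = u" "head H a = v"
        by (auto simp: arcs_ends_conv)
      then have "e = g a"
        using g[OF a(1)] uv e G.no_multi_arcs[of e "g a"] by (auto simp: arc_to_ends_def)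
      then show "e \<in> g ` arcs H" using a by auto
    qed (use g in auto)
    then show ?thesis by (intro pre_digraph.equality) (auto simp: hom_def)
  qed
  ultimately show ?thesis
    using G.induced_induce[OF sub] unfolding digraph_iso_def by blast
qed

context graph
begin

lemma dominates_sym: "u \<rightarrow>\<^bsub>G\<^esub> v \<Longrightarrow> v \<rightarrow>\<^bsub>G\<^esub> u"
  using sym_arcs by (rule arcs_ends_symmetric)

lemma dominates_irrefl: "\<not> u \<rightarrow>\<^bsub>G\<^esub> u"
  using adj_not_same by blast

lemma P5_free_cases:
  assumes free: "induced_free {P5, K4_minus} G"
    and path: "u \<rightarrow>\<^bsub>G\<^esub> v" "v \<rightarrow>\<^bsub>G\<^esub> w" "w \<rightarrow>\<^bsub>G\<^esub> x" "x \<rightarrow>\<^bsub>G\<^esub> y"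
  shows "u \<rightarrow>\<^bsub>G\<^esub> w \<or> u \<rightarrow>\<^bsub>G\<^esub> x \<or> u \<rightarrow>\<^bsub>G\<^esub> y \<or> v \<rightarrow>\<^bsub>G\<^esub> x \<or> v \<rightarrow>\<^bsub>G\<^esub> y \<or> w \<rightarrow>\<^bsub>G\<^esub> y"
proof (rule ccontr)
  assume no: "\<not> ?thesis"
  let ?f = "(!) [u, v, w, x, y]"
  have V: "verts P5 = {0, 1, 2, 3, 4}" unfolding P5_def by auto
  have "distinct [u, v, w, x, y]"
    using path no dominates_sym dominates_irrefl by (simp; metis)
  then have "inj_on ?f (verts P5)" unfolding V by (auto simp: inj_on_def)
  moreover have "?f ` verts P5 \<subseteq> verts G"
    unfolding V using path[THEN adj_in_verts(1)] path[THEN adj_in_verts(2)] by auto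
  moreover have "(i, j) \<in> arcs_ends P5 \<longleftrightarrow> ?f i \<rightarrow>\<^bsub>G\<^esub> ?f j" if "i \<in> verts P5" "j \<in> verts P5" for i j
  proof -
    have E: "arcs_ends P5 = {(i, j). i < 5 \<and> j < 5 \<and> (j = Suc i \<or> i = Suc j)}"
      unfolding P5_def by simp
    have no': "\<not> w \<rightarrow>\<^bsub>G\<^esub> u" "\<not> x \<rightarrow>\<^bsub>G\<^esub> u" "\<not> y \<rightarrow>\<^bsub>G\<^esub> u" "\<not> x \<rightarrow>\<^bsub>G\<^esub> v" "\<not> y \<rightarrow>\<^bsub>G\<^esub> v" "\<not> y \<rightarrow>\<^bsub>G\<^esub> w"
      using no dominates_sym by blast+
    show ?thesis
      using that no no' path path[THEN dominates_sym] dominates_irrefl unfolding V E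
      by (elim insertE emptyE) simp_all
  qed
  ultimately show False
    using induced_copy[OF graph_axioms graph_P5] free unfolding induced_free_def by blast
qed

lemma K4_minus_free_closed:
  assumes free: "induced_free {P5, K4_minus} G"
    and adj: "u \<rightarrow>\<^bsub>G\<^esub> v" "u \<rightarrow>\<^bsub>G\<^esub> w" "v \<rightarrow>\<^bsub>G\<^esub> w" "u \<rightarrow>\<^bsub>G\<^esub> x" "v \<rightarrow>\<^bsub>G\<^esub> x" and "w \<noteq> x"
  shows "w \<rightarrow>\<^bsub>G\<^esub> x"
proof (rule ccontr)
  assume no: "\<not> w \<rightarrow>\<^bsub>G\<^esub> x"
  let ?f = "(!) [w, x, u, v]"
  have V: "verts K4_minus = {0, 1, 2, 3}" unfolding K4_minus_def by auto
  have "distinct [w, x, u, v]"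
    using adj \<open>w \<noteq> x\<close> dominates_irrefl by auto
  then have "inj_on ?f (verts K4_minus)" unfolding V by (auto simp: inj_on_def)
  moreover have "?f ` verts K4_minus \<subseteq> verts G"
    unfolding V using adj[THEN adj_in_verts(1)] adj[THEN adj_in_verts(2)] by auto
  moreover have "(i, j) \<in> arcs_ends K4_minus \<longleftrightarrow> ?f i \<rightarrow>\<^bsub>G\<^esub> ?f j"
    if "i \<in> verts K4_minus" "j \<in> verts K4_minus" for i j
  proof -
    have E: "arcs_ends K4_minus = {(i, j). i < 4 \<and> j < 4 \<and> i \<noteq> j} - {(0, 1), (1, 0)}"
      unfolding K4_minus_def by simp
    have no': "\<not> x \<rightarrow>\<^bsub>G\<^esub> w" using no dominates_sym by blast
    show ?thesis
      using that no no' adj adj[THEN dominates_sym] dominates_irrefl unfolding V E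
      by (elim insertE emptyE) simp_all
  qed
  ultimately show False
    using induced_copy[OF graph_axioms graph_K4_minus] free unfolding induced_free_def by blast
qed

lemma connected_set_delete:
  assumes "k_connected 2 G"
  shows "connected_set (dominates G) (verts G - {v})"
proof -
  let ?S = "verts G - {v}"
  have "card (verts G \<inter> {v}) < 2" by (rule le_less_trans[OF card_mono[of "{v}"]]) auto
  then have "connected (G \<restriction> (verts G - verts G \<inter> {v}))"
    using assms unfolding k_connected_def by blast
  then have conn: "connected (G \<restriction> ?S)" by (simp add: Diff_Int_distrib2 Diff_Int)
  have sym_step: "a \<rightarrow>\<^bsub>G\<^esub> b \<and> a \<in> ?S \<and> b \<in> ?S" if "(a, b) \<in> (arcs_ends (G \<restriction> ?S))\<^sup>s" for a b
    using that dominates_sym by (auto simp: symcl_def arcs_ends_conv)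
  show ?thesis
    unfolding connected_set_def
  proof (intro ballI)
    fix a b assume ab: "a \<in> ?S" "b \<in> ?S"
    then have "(a, b) \<in> rtrancl_on ?S ((arcs_ends (G \<restriction> ?S))\<^sup>s)"
      using conn unfolding connected_conv by auto
    then show "(\<lambda>x y. x \<rightarrow>\<^bsub>G\<^esub> y \<and> x \<in> ?S \<and> y \<in> ?S)\<^sup>*\<^sup>* a b"
    proof (induction rule: rtrancl_on_induct)
      case (step x y)
      then show ?case
        using sym_step[of x y] by (intro rtranclp.rtrancl_into_rtrancl[of _ a x y]) auto
    qed (use ab in simp)
  qed
qed

lemma cas_successively:
  "cas u p v \<Longrightarrow> set p \<subseteq> arcs G \<Longrightarrow> successively (dominates G) (u # map (head G) p)"
proof (induction p arbitrary: u)
  case (Cons e p)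
  then have "u \<rightarrow>\<^bsub>G\<^esub> head G e" by (auto simp: arcs_ends_conv)
  then show ?case using Cons by auto
qed simp

lemma cas_last: "cas u p v \<Longrightarrow> last (u # map (head G) p) = v"
  by (induction p arbitrary: u) auto

lemma cas_heads: "cas u p v \<Longrightarrow> head G ` set p \<subseteq> insert v (tail G ` set p)"
proof (induction p arbitrary: u)
  case (Cons e p)
  then show ?case by (cases p) auto
qed simp

lemma graph_cycle_vertices:
  assumes "graph_cycle G C"
  shows "is_cycle (dominates G) (map (head G) C)" "set (map (head G) C) \<subseteq> cycle_verts G C"
    "set (map (head G) C) \<subseteq> verts G"
proof -
  obtain u where u: "awalk u C u" "distinct (tl (awalk_verts u C))" "C \<noteq> []"
    and len: "3 \<le> length C"
    using assms unfolding graph_cycle_def cycle_def by blast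
  then have cas: "cas u C u" and arcs: "set C \<subseteq> arcs G" unfolding awalk_def by auto
  have "distinct (map (head G) C)" using u(2,3) awalk_verts_conv'[OF cas] by simp
  moreover have "successively (dominates G) (u # map (head G) C)"
    using cas arcs by (rule cas_successively)
  moreover have "last (map (head G) C) = u" using cas_last[OF cas] u(3) by simp
  ultimately show "is_cycle (dominates G) (map (head G) C)"
    using u(3) len unfolding is_cycle_def by (auto simp: successively_Cons)
  have "u \<in> tail G ` set C" using cas u(3) by (cases C) auto
  then show "set (map (head G) C) \<subseteq> cycle_verts G C"
    using cas_heads[OF cas] unfolding cycle_verts_def by auto
  show "set (map (head G) C) \<subseteq> verts G" using arcs by auto
qed

lemma successively_awalk:
  "u \<in> verts G \<Longrightarrow> successively (dominates G) (u # zs) \<Longrightarrow>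
    \<exists>p. awalk u p (last (u # zs)) \<and> map (head G) p = zs"
proof (induction zs arbitrary: u)
  case Nil
  then show ?case by (intro exI[of _ "[]"]) (simp add: awalk_Nil_iff)
next
  case (Cons z zs)
  then have "u \<rightarrow>\<^bsub>G\<^esub> z" by simp
  then obtain e where e: "e \<in> arcs G" "tail G e = u" "head G e = z" by (auto simp: arcs_ends_conv)
  obtain p where "awalk z p (last (z # zs))" "map (head G) p = zs"
    using Cons.IH[of z] Cons.prems(2) adj_in_verts(2)[OF \<open>u \<rightarrow>\<^bsub>G\<^esub> z\<close>] by auto
  then show ?case using e by (intro exI[of _ "e # p"]) (simp add: awalk_Cons_iff)
qed

lemma graph_cycle_of_vertices:
  assumes "is_cycle (dominates G) zs"
  obtains C where "graph_cycle G C" "length C = length zs"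
proof -
  let ?u = "last zs"
  have zs: "distinct zs" "3 \<le> length zs" "successively (dominates G) zs" "?u \<rightarrow>\<^bsub>G\<^esub> hd zs"
    using assms unfolding is_cycle_def by auto
  then have "successively (dominates G) (?u # zs)" by (cases zs) auto
  then obtain p where p: "awalk ?u p (last (?u # zs))" "map (head G) p = zs"
    using successively_awalk adj_in_verts(1)[OF zs(4)] by blast
  have ne: "zs \<noteq> []" "p \<noteq> []" using zs(2) p(2) by auto
  then have "awalk ?u p ?u" using p(1) by simp
  moreover from this have "tl (awalk_verts ?u p) = zs"
    using awalk_verts_conv'[of ?u p ?u] p(2) ne unfolding awalk_def by simp
  ultimately have "cycle p" unfolding cycle_def using zs(1) ne(2) by auto
  moreover have "length p = length zs" using p(2) by auto
  ultimately show thesis using that zs(2) unfolding graph_cycle_def by simp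
qed

text \<open>A vertex \<open>v\<close> has two neighbours, since deleting one of them leaves \<open>v\<close> connected to a third vertex;
  a path between them that avoids \<open>v\<close> closes up to a cycle through \<open>v\<close>.\<close>
lemma cycle_exists:
  assumes "k_connected 2 G"
  obtains zs where "is_cycle (dominates G) zs"
proof -
  have card: "2 < card (verts G)" using assms unfolding k_connected_def by simp
  note conn = connected_set_delete[OF assms]
  have neighbour: "\<exists>s. v \<rightarrow>\<^bsub>G\<^esub> s \<and> s \<noteq> u" if "v \<in> verts G" "v \<noteq> u" for u v
  proof -
    have "\<not> verts G \<subseteq> {u, v}"
      using card card_mono[of "{u, v}" "verts G"] card_insert_le_m1[of 2 "{v}" u] by auto
    then obtain w where w: "w \<in> verts G - {u}" "w \<noteq> v" by blast
    show ?thesis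
    proof (rule ccontr)
      assume no: "\<not> ?thesis"
      have "w = v"
        by (rule connected_set_induct[OF conn, of v u w "\<lambda>x. x = v"]) (use that w no in auto)
      with w show False by simp
    qed
  qed
  obtain v where v: "v \<in> verts G" using card by fastforce
  obtain w where w: "w \<in> verts G" "w \<noteq> v"
    using card card_mono[of "{v}" "verts G"] by fastforce
  obtain u where u: "v \<rightarrow>\<^bsub>G\<^esub> u" using neighbour[of v w] v w by auto
  have "v \<noteq> u" using u dominates_irrefl by blast
  obtain s where s: "v \<rightarrow>\<^bsub>G\<^esub> s" "s \<noteq> u" using neighbour[of v u] v \<open>v \<noteq> u\<close> by auto
  have "u \<in> verts G - {v}" "s \<in> verts G - {v}"
    using u s dominates_irrefl adj_in_verts by blast+
  then obtain p where p: "p \<noteq> []" "distinct p" "set p \<subseteq> verts G - {v}"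
    "successively (dominates G) p" "hd p = u" "last p = s"
    by (rule connected_set_path[OF conn])
  have "2 \<le> length p"
  proof (rule ccontr)
    assume "\<not> 2 \<le> length p"
    then obtain a where "p = [a]" using p(1) by (cases p) (auto simp: Suc_le_eq)
    then show False using p s by simp
  qed
  then have "is_cycle (dominates G) (v # p)"
    unfolding is_cycle_def using p u s(1) dominates_sym by (auto simp: successively_Cons)
  then show thesis by (rule that)
qed

lemma longest_cycle_exists:
  assumes "k_connected 2 G"
  obtains C where "longest_cycle G C"
proof -
  have "length C \<le> card (verts G)" if "graph_cycle G C" for C
  proof -
    have "length C = card (set (map (head G) C))"
      using graph_cycle_vertices(1)[OF that] distinct_card[of "map (head G) C"]
      unfolding is_cycle_def by (simp del: set_map)
    also have "\<dots> \<le> card (verts G)"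
      using graph_cycle_vertices(3)[OF that] by (intro card_mono) auto
    finally show ?thesis .
  qed
  moreover obtain C where "graph_cycle G C"
    using cycle_exists[OF assms] graph_cycle_of_vertices by metis
  ultimately obtain D where "graph_cycle G D" "\<forall>C. graph_cycle G C \<longrightarrow> length C \<le> length D"
    using ex_has_greatest_nat[of "graph_cycle G" C length "Suc (card (verts G))"] by (auto simp: less_Suc_eq_le)
  then show thesis using that unfolding longest_cycle_def by blast
qed

text \<open>The component consists of the vertices reachable from \<open>a\<close> off the cycle. For \<open>robust\<close>: in \<open>G - v\<close>
  the component still reaches the cycle, and the first vertex on the way that is not in \<open>D\<close> lies on
  the cycle.\<close>
lemma outside_component_of_edge:
  assumes "k_connected 2 G" and free: "induced_free {P5, K4_minus} G"
    and zs: "is_cycle (dominates G) zs" "set zs \<subseteq> verts G"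
    and longest: "\<And>ws. is_cycle (dominates G) ws \<Longrightarrow> length ws \<le> length zs"
    and ab: "a \<rightarrow>\<^bsub>G\<^esub> b" "a \<notin> set zs" "b \<notin> set zs"
  shows "outside_component (dominates G) (\<lambda>i. zs ! nat (i mod int (length zs))) (int (length zs))
    {v. (\<lambda>x y. x \<rightarrow>\<^bsub>G\<^esub> y \<and> x \<notin> set zs \<and> y \<notin> set zs)\<^sup>*\<^sup>* a v}"
proof -
  define n where "n = length zs"
  define c where "c i = zs ! nat (i mod int n)" for i
  define R where "R x y \<longleftrightarrow> x \<rightarrow>\<^bsub>G\<^esub> y \<and> x \<notin> set zs \<and> y \<notin> set zs" for x y
  define D where "D = {v. R\<^sup>*\<^sup>* a v}"
  have n: "3 \<le> n" using zs unfolding is_cycle_def n_def by simp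
  have idx: "nat (i mod int n) < n" for i using n by (simp add: nat_less_iff)
  have c_in: "c i \<in> set zs" for i unfolding c_def using idx unfolding n_def by simp
  have c_onto: "\<exists>i. c i = z" if "z \<in> set zs" for z
  proof -
    obtain k where "k < n" "zs ! k = z"
      using \<open>z \<in> set zs\<close> unfolding n_def by (auto simp: in_set_conv_nth)
    then have "c (int k) = z" unfolding c_def by simp
    then show ?thesis ..
  qed
  have D_off: "v \<notin> set zs \<and> v \<in> verts G" if "v \<in> D" for v
  proof -
    have "R\<^sup>*\<^sup>* a v" using that unfolding D_def by simp
    then show ?thesis
      by (induction rule: rtranclp_induct) (use ab adj_in_verts in \<open>auto simp: R_def\<close>)
  qed
  have D_closed: "y \<in> D" if "x \<in> D" "x \<rightarrow>\<^bsub>G\<^esub> y" "y \<notin> set zs" for x y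
    using that D_off[of x] unfolding D_def
    by (auto intro: rtranclp.rtrancl_into_rtrancl simp: R_def)
  have aD: "a \<in> D" "b \<in> D" using ab D_closed unfolding D_def by (auto simp: R_def)
  have "symp R" unfolding R_def by (auto simp: symp_def dest: dominates_sym)
  then have symR: "R\<^sup>*\<^sup>* x y \<Longrightarrow> R\<^sup>*\<^sup>* y x" for x y by (metis sympD symp_rtranclp)
  have "outside_component (dominates G) c (int n) D"
  proof
    show "u \<rightarrow>\<^bsub>G\<^esub> v \<Longrightarrow> v \<rightarrow>\<^bsub>G\<^esub> u" for u v by (rule dominates_sym)
    show "\<not> u \<rightarrow>\<^bsub>G\<^esub> u" for u by (rule dominates_irrefl)
    show "u \<rightarrow>\<^bsub>G\<^esub> w \<or> u \<rightarrow>\<^bsub>G\<^esub> x \<or> u \<rightarrow>\<^bsub>G\<^esub> y \<or> v \<rightarrow>\<^bsub>G\<^esub> x \<or> v \<rightarrow>\<^bsub>G\<^esub> y \<or> w \<rightarrow>\<^bsub>G\<^esub> y"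
      if "u \<rightarrow>\<^bsub>G\<^esub> v" "v \<rightarrow>\<^bsub>G\<^esub> w" "w \<rightarrow>\<^bsub>G\<^esub> x" "x \<rightarrow>\<^bsub>G\<^esub> y" for u v w x y
      using P5_free_cases[OF free that] .
    show "w \<rightarrow>\<^bsub>G\<^esub> x" if "u \<rightarrow>\<^bsub>G\<^esub> v" "u \<rightarrow>\<^bsub>G\<^esub> w" "v \<rightarrow>\<^bsub>G\<^esub> w" "u \<rightarrow>\<^bsub>G\<^esub> x" "v \<rightarrow>\<^bsub>G\<^esub> x" "w \<noteq> x" for u v w x
      using K4_minus_free_closed[OF free that] .
    show "3 \<le> int n" using n by simp
    show "c (i + int n) = c i" for i unfolding c_def by simp
    show "int n dvd i - j" if "c i = c j" for i j
    proof -
      have "nat (i mod int n) = nat (j mod int n)"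
        using that idx zs(1) unfolding c_def is_cycle_def n_def by (simp add: nth_eq_iff_index_eq)
      then have "i mod int n = j mod int n" using n by (simp add: nat_eq_iff)
      then show ?thesis by (simp add: mod_eq_dvd_iff)
    qed
    show "c i \<rightarrow>\<^bsub>G\<^esub> c (i + 1)" for i
    proof (cases "i mod int n = int n - 1")
      case True
      then have "(i + 1) mod int n = 0" using n by (metis diff_add_cancel mod_add_left_eq mod_self)
      moreover have "nat (int n - 1) = n - 1" "zs \<noteq> []" using n unfolding n_def by auto
      ultimately have "c i = last zs" "c (i + 1) = hd zs"
        unfolding c_def True by (simp_all add: n_def last_conv_nth hd_conv_nth)
      then show ?thesis using zs(1) unfolding is_cycle_def by simp
    next
      case False
      define k where "k = nat (i mod int n)"
      have "0 \<le> i mod int n" "i mod int n < int n" using n by auto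
      with False have k: "i mod int n = int k" "Suc k < n" unfolding k_def by linarith+
      have "(i + 1) mod int n = (int k + 1) mod int n" unfolding k(1)[symmetric] by presburger
      also have "\<dots> = int (Suc k)" using k(2) by simp
      finally have "c (i + 1) = zs ! Suc k" unfolding c_def by (simp only: nat_int)
      moreover have "c i = zs ! k" unfolding c_def k(1) by simp
      ultimately show ?thesis
        using zs(1) k(2) unfolding is_cycle_def n_def by (auto simp: successively_conv_nth)
    qed
    show "int (length ws) \<le> int n" if "is_cycle (dominates G) ws" for ws
      using longest[OF that] unfolding n_def by simp
    show "c i \<notin> D" for i using D_off c_in by blast
    show "connected_set (dominates G) D"
      unfolding connected_set_def
    proof (intro ballI)
      fix x y assume xy: "x \<in> D" "y \<in> D"
      then have "R\<^sup>*\<^sup>* x y" using symR unfolding D_def by (metis mem_Collect_eq rtranclp_trans)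
      then show "(\<lambda>u v. u \<rightarrow>\<^bsub>G\<^esub> v \<and> u \<in> D \<and> v \<in> D)\<^sup>*\<^sup>* x y"
      proof (induction rule: rtranclp_induct)
        case (step v w)
        then have "v \<in> D" using xy unfolding D_def by (metis mem_Collect_eq rtranclp_trans)
        moreover from this have "w \<in> D" using D_closed step unfolding R_def by blast
        ultimately show ?case
          using step unfolding R_def by (metis (mono_tags, lifting) rtranclp.rtrancl_into_rtrancl)
      qed simp
    qed
    show "\<exists>d\<in>D. \<exists>i. d \<rightarrow>\<^bsub>G\<^esub> c i \<and> d \<noteq> v \<and> c i \<noteq> v" for v
    proof (rule ccontr)
      assume no: "\<not> ?thesis"
      have "\<exists>d\<in>D. d \<noteq> v" using aD ab dominates_irrefl by metis
      then obtain d where d: "d \<in> D" "d \<noteq> v" by blast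
      have "hd zs \<noteq> last zs" using zs(1) dominates_irrefl unfolding is_cycle_def by metis
      then obtain z where z: "z \<in> set zs" "z \<noteq> v" using n unfolding n_def
        by (metis hd_in_set last_in_set list.size(3) not_numeral_le_zero)
      have "z \<in> D"
      proof (rule connected_set_induct[OF connected_set_delete[OF assms(1)], of d v z "\<lambda>x. x \<in> D"])
        fix x y assume "x \<in> verts G - {v}" "y \<in> verts G - {v}" "x \<rightarrow>\<^bsub>G\<^esub> y" "x \<in> D"
        then show "y \<in> D" using no D_closed c_onto by (metis DiffD2 insertI1)
      qed (use d z D_off zs(2) in auto)
      then show False using D_off z by blast
    qed
  qed
  then show ?thesis unfolding c_def D_def R_def n_def .
qed

end

theorem theorem2:
  fixes G :: "('a, 'b) pre_digraph"
  assumes "graph G"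
    and "k_connected 2 G"
    and "induced_free {P5, K4_minus} G"
  shows "\<exists>C. longest_cycle G C \<and> dominating_cycle G C"
proof -
  interpret graph G by (rule assms(1))
  obtain C where C: "longest_cycle G C" by (rule longest_cycle_exists[OF assms(2)])
  then have cyc: "graph_cycle G C" unfolding longest_cycle_def by simp
  note vs = graph_cycle_vertices[OF cyc]
  have "tail G e \<in> cycle_verts G C \<or> head G e \<in> cycle_verts G C" if e: "e \<in> arcs G" for e
  proof (rule ccontr)
    assume off: "\<not> ?thesis"
    have "length ws \<le> length (map (head G) C)" if "is_cycle (dominates G) ws" for ws
      using graph_cycle_of_vertices[OF that] C unfolding longest_cycle_def by (metis length_map)
    moreover have "tail G e \<rightarrow>\<^bsub>G\<^esub> head G e" using e by (auto simp: arcs_ends_conv)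
    ultimately show False
      using outside_component.impossible[OF
          outside_component_of_edge[OF assms(2,3) vs(1,3), of "tail G e" "head G e"]] off vs(2)
      by blast
  qed
  then have "dominating_cycle G C" using cyc unfolding dominating_cycle_def by simp
  with C show ?thesis by blast
qed

end
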